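(* The functions $f_0,g_0:[-1,1]\rightarrow\mathbb{R}$, \[f_0(\rho)=\rho+\frac{\sqrt{1-\rho^2}}{\arcsin\rho+\frac{\pi}{2}}-\frac{\pi}{2}\frac{(1+\rho)^2}{(\arcsin\rho+\frac{\pi}{2})^2},\] \[g_0(\rho)=\frac{\rho(\arcsin\rho+\frac{\pi}{2})^2+\sqrt{1-\rho^2}(\arcsin\rho+\frac{\pi}{2})-\frac{\pi}{2}(1+\rho)^2}{(\arcsin\rho+\frac{\pi}{2})^2+\rho\sqrt{1-\rho^2}(\arcsin\rho+\frac{\pi}{2})-\frac{\pi}{2}(1+\rho)^2},\] are absolutely monotone on $[0,1]$, i.e., all their derivatives are nonnegative there.
   Formalization: Nonnegativity of all derivatives is stated on [0,1), with one-sided derivatives at 0 and continuity on [0,1]; at the endpoint 1 derivatives are not required, since f_0'(1) = +∞ does not exist as a finite number. *)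

theory Defs
  imports "HOL-Analysis.Analysis"
begin

definition f0 :: "real \<Rightarrow> real" where
  "f0 \<rho> = \<rho> + sqrt (1 - \<rho>\<^sup>2) / (arcsin \<rho> + pi/2)
           - (pi/2) * (1 + \<rho>)\<^sup>2 / (arcsin \<rho> + pi/2)\<^sup>2"

definition g0 :: "real \<Rightarrow> real" where
  "g0 \<rho> = (\<rho> * (arcsin \<rho> + pi/2)\<^sup>2 + sqrt (1 - \<rho>\<^sup>2) * (arcsin \<rho> + pi/2)
              - (pi/2) * (1 + \<rho>)\<^sup>2)
          / ((arcsin \<rho> + pi/2)\<^sup>2 + \<rho> * sqrt (1 - \<rho>\<^sup>2) * (arcsin \<rho> + pi/2)
              - (pi/2) * (1 + \<rho>)\<^sup>2)"

definition absolutely_monotone_01 :: "(real \<Rightarrow> real) \<Rightarrow> bool" where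
  "absolutely_monotone_01 f \<longleftrightarrow>
     continuous_on {0..1} f \<and>
     (\<exists>D :: nat \<Rightarrow> real \<Rightarrow> real.
        (\<forall>x\<in>{0..<1}. D 0 x = f x) \<and>
        (\<forall>n. \<forall>x\<in>{0..<1}. (D n has_real_derivative D (Suc n) x) (at x within {0..<1})) \<and>
        (\<forall>n. \<forall>x\<in>{0..<1}. D n x \<ge> 0))"

end

theory Submission
  imports Defs "HOL-Complex_Analysis.Complex_Analysis" "HOL-Real_Asymp.Real_Asymp"
begin

text \<open>
  Put \<open>\<rho> = - cos t\<close>, so that \<open>arcsin \<rho> + pi/2 = t\<close> and \<open>sqrt (1 - \<rho>\<^sup>2) = sin t\<close>. In the variable \<open>t\<close>
  the two functions become \<open>A / t\<^sup>2\<close> and \<open>A / B\<close> with \<open>A\<close>, \<open>B\<close> entire, even, real on the real axis and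
  divisible by \<open>t\<^sup>4\<close>; hence as functions of \<open>\<rho>\<close> they are regular at \<open>-1\<close> and only branch at \<open>1\<close>. A Taylor
  coefficient at \<open>\<rho> = 0\<close> is the residue at \<open>t = pi/2\<close> of \<open>F t * sin t / (- cos t) ^ (n + 1)\<close>. Integrate
  over the boundary of \<open>[0, pi] \<times> [-R, R]\<close>: the side on the imaginary axis contributes nothing because the
  integrand is odd, the horizontal sides vanish as \<open>R \<rightarrow> \<infinity>\<close>, the two halves of the remaining side contribute
  equally by reflection, and on \<open>t = pi + i s\<close> the real part of the integrand is
  \<open>Im F * sinh s / cosh s ^ (n + 1)\<close>. For \<open>f0\<close> this density is nonnegative, which settles \<open>n \<ge> 2\<close> (the
  horizontal sides do not vanish for smaller \<open>n\<close>); the first two coefficients are \<open>0\<close> and \<open>(1 - 2/pi)\<^sup>2\<close>.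

  For \<open>g0\<close> the density is \<open>pi * sinh s ^ 4 * Q s / \<bar>B\<bar>\<^sup>2\<close> with \<open>Q\<close> decreasing and changing sign near
  \<open>s = 1.0835\<close>. Therefore the coefficients of \<open>(x - \<rho>) * g0\<close> are considered instead, where \<open>x = 1.653\<close>
  compensates the change of sign; as \<open>g0 0 = 0\<close>, their nonnegativity implies that of the coefficients of
  \<open>g0\<close>. The denominator \<open>B\<close> has a pair of conjugate zeros at \<open>t \<approx> pi - 0.0004 \<plusminus> 1.0883 i\<close>, extremely close
  to the line of integration. The contour avoids them by a detour around a box of side \<open>0.01\<close>, on which
  \<open>(x - \<rho>) * g0\<close> is nearly the constant \<open>1.14\<close>; subtracting this constant, which only affects the
  coefficient of index \<open>0\<close>, makes the contribution of the detour smaller than a part of the positive main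
  term. That \<open>B\<close> has no further zeros follows from the open mapping theorem: \<open>B / (1 - cos t)\<^sup>2\<close> takes no
  value in \<open>(-\<infinity>, 0]\<close> on the boundary of the remaining region, so it cannot take one of minimal real part
  inside.
\<close>

section \<open>Absolute monotonicity and Taylor coefficients\<close>

lemma has_real_derivative_Re_of_real:
  assumes "(h has_field_derivative d) (at (of_real x))"
  shows "((\<lambda>x. Re (h (of_real x))) has_real_derivative Re d) (at x within S)"
proof -
  have "((\<lambda>x. h (of_real x)) has_vector_derivative d) (at x within S)"
    using assms by (rule has_vector_derivative_real_field)
  then show ?thesis
    by (simp add: has_real_derivative_iff_has_vector_derivative has_vector_derivative_complex_iff)
qed

lemma Re_divide_fact: "Re (z / fact n) = Re z / fact n"
  using Re_divide_of_real[of z "fact n"] by (simp only: of_real_fact)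

lemma Re_nonneg_of_Taylor_coeffs_nonneg:
  assumes hol: "h holomorphic_on ball 0 r"
    and coeffs: "\<And>n. 0 \<le> Re ((deriv ^^ n) h 0)"
    and x: "0 \<le> x" "x < r"
  shows "0 \<le> Re (h (of_real x))"
proof -
  have "(\<lambda>n. (deriv ^^ n) h 0 / fact n * (of_real x - 0) ^ n) sums h (of_real x)"
    by (rule holomorphic_power_series[OF hol]) (use x in simp)
  then have "(\<lambda>n. Re ((deriv ^^ n) h 0 / fact n * of_real (x ^ n))) sums Re (h (of_real x))"
    by (intro sums_Re) simp
  moreover have "Re ((deriv ^^ n) h 0 / fact n * of_real (x ^ n)) =
      Re ((deriv ^^ n) h 0) / fact n * x ^ n" for n
    unfolding Re_divide_fact[symmetric]
    by (simp only: times_complex.sel Re_complex_of_real Im_complex_of_real mult_zero_right diff_zero)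
  ultimately have "(\<lambda>n. Re ((deriv ^^ n) h 0) / fact n * x ^ n) sums Re (h (of_real x))"
    by (simp only:)
  then show ?thesis
    by (rule sums_le[OF _ sums_zero, rotated]) (use coeffs x in simp)
qed

lemma absolutely_monotone_01_of_Taylor_coeffs:
  assumes hol: "h holomorphic_on ball 0 1"
    and coeffs: "\<And>n. 0 \<le> Re ((deriv ^^ n) h 0)"
    and f: "\<And>x. x \<in> {0..<1} \<Longrightarrow> f x = Re (h (of_real x))"
    and cont: "continuous_on {0..1} f"
  shows "absolutely_monotone_01 f"
  unfolding absolutely_monotone_01_def
proof (intro conjI exI[of _ "\<lambda>n x. Re ((deriv ^^ n) h (of_real x))"] ballI allI)
  show "continuous_on {0..1} f" by (rule cont)
  fix x :: real assume x: "x \<in> {0..<1}"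
  then show "Re ((deriv ^^ 0) h (of_real x)) = f x" using f by simp
  fix n :: nat
  have hol': "(deriv ^^ n) h holomorphic_on ball 0 1"
    by (simp add: hol holomorphic_higher_deriv)
  then have "((deriv ^^ n) h has_field_derivative (deriv ^^ Suc n) h (of_real x)) (at (of_real x))"
    using holomorphic_derivI[OF hol' open_ball, of "of_real x"] x by simp
  then show "((\<lambda>x. Re ((deriv ^^ n) h (of_real x))) has_real_derivative
      Re ((deriv ^^ Suc n) h (of_real x))) (at x within {0..<1})"
    by (rule has_real_derivative_Re_of_real)
  have "0 \<le> Re ((deriv ^^ m) ((deriv ^^ n) h) 0)" for m
    using coeffs[of "m + n"] by (simp add: funpow_add)
  then show "0 \<le> Re ((deriv ^^ n) h (of_real x))"
    using x by (intro Re_nonneg_of_Taylor_coeffs_nonneg[OF hol']) auto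
qed

lemma higher_deriv_linear_times:
  assumes f: "f holomorphic_on S" and S: "open S" "z \<in> S"
  shows "(deriv ^^ Suc n) (\<lambda>z. (a - z) * f z - k) z =
    (a - z) * (deriv ^^ Suc n) f z - of_nat (Suc n) * (deriv ^^ n) f z"
proof -
  have linear: "(deriv ^^ i) (\<lambda>z. a - z) z = (if i = 0 then a - z else if i = 1 then - 1 else 0)" for i
    using S by (subst higher_deriv_diff[of _ UNIV]) (auto intro!: holomorphic_intros)
  have "(deriv ^^ Suc n) (\<lambda>z. (a - z) * f z - k) z = (deriv ^^ Suc n) (\<lambda>z. (a - z) * f z) z"
    using f S by (subst higher_deriv_diff[of _ S]) (auto intro!: holomorphic_intros)
  also have "\<dots> =
      (\<Sum>i=0..Suc n. of_nat (Suc n choose i) * (deriv ^^ i) (\<lambda>z. a - z) z * (deriv ^^ (Suc n - i)) f z)"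
    using f S by (intro higher_deriv_mult[of _ S]) (auto intro!: holomorphic_intros)
  also have "\<dots> =
      (\<Sum>i\<in>{0,1}. of_nat (Suc n choose i) * (deriv ^^ i) (\<lambda>z. a - z) z * (deriv ^^ (Suc n - i)) f z)"
    by (rule sum.mono_neutral_right) (auto simp: linear simp del: funpow.simps)
  also have "\<dots> = (a - z) * (deriv ^^ Suc n) f z - of_nat (Suc n) * (deriv ^^ n) f z"
    by (simp add: linear algebra_simps del: funpow.simps)
  finally show ?thesis .
qed

section \<open>Taylor coefficients as residues\<close>

lemma residue_deriv_eq_0:
  assumes "open S" "z \<in> S" "f holomorphic_on S - {z}"
  shows "residue (deriv f) z = 0"
proof -
  have open': "open (S - {z})" using assms(1) by (simp add: open_delete)
  obtain r where r: "0 < r" "cball z r \<subseteq> S" using assms(1,2) open_contains_cball by blast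
  have circle: "path_image (circlepath z r) \<subseteq> S - {z}" using r by (auto simp: sphere_def)
  have "(f has_field_derivative deriv f t) (at t within S - {z})" if "t \<in> S - {z}" for t
    using holomorphic_derivI[OF assms(3) open' that] by (rule has_field_derivative_at_within)
  then have "(deriv f has_contour_integral 0) (circlepath z r)"
    using contour_integral_primitive[of "S - {z}" f "deriv f" "circlepath z r"] circle by simp
  moreover have "(deriv f has_contour_integral 2 * pi * \<i> * residue (deriv f) z) (circlepath z r)"
    using assms open' r by (intro base_residue[where s = S] holomorphic_deriv)
  ultimately have "2 * pi * \<i> * residue (deriv f) z = 0" by (metis has_contour_integral_unique)
  then show ?thesis by simp
qed

lemma residue_comp_over_simple_zero:
  assumes S: "open S" "z \<in> S"
    and g: "g holomorphic_on S" "g z = 0" "deriv g z \<noteq> 0" "\<And>t. t \<in> S - {z} \<Longrightarrow> g t \<noteq> 0"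
    and f: "f holomorphic_on S"
  shows "residue (\<lambda>t. f t * deriv g t / g t) z = f z"
proof (rule residue_simple'[OF S])
  show "(\<lambda>t. f t * deriv g t / g t) holomorphic_on S - {z}"
    by (intro holomorphic_intros holomorphic_on_subset[OF f] holomorphic_on_subset[OF g(1)]
        holomorphic_on_subset[OF holomorphic_deriv[OF g(1) S(1)]] g(4)) auto
  have "(g has_field_derivative deriv g z) (at z)"
    using holomorphic_derivI[OF g(1) S] .
  then have "((\<lambda>t. g t / (t - z)) \<longlongrightarrow> deriv g z) (at z)"
    by (simp add: has_field_derivative_iff g(2))
  moreover have "isCont (\<lambda>t. f t * deriv g t) z"
    by (intro continuous_intros field_differentiable_imp_continuous_at
        holomorphic_on_imp_differentiable_at[OF _ S] f holomorphic_deriv[OF g(1) S(1)])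
  then have "((\<lambda>t. f t * deriv g t) \<longlongrightarrow> f z * deriv g z) (at z)"
    by (simp add: isCont_def)
  ultimately have "((\<lambda>t. f t * deriv g t / (g t / (t - z))) \<longlongrightarrow> f z * deriv g z / deriv g z) (at z)"
    using g(3) by (intro tendsto_divide)
  then show "((\<lambda>t. f t * deriv g t / g t * (t - z)) \<longlongrightarrow> f z) (at z)"
    using g(3) by simp
qed

lemma deriv_comp_over_power:
  fixes g h :: "complex \<Rightarrow> complex"
  assumes g: "(g has_field_derivative g') (at t)" "g t \<noteq> 0"
    and h: "(h has_field_derivative h') (at (g t))"
  shows "deriv (\<lambda>t. h (g t) / g t ^ n) t = h' * g' / g t ^ n - of_nat n * (h (g t) * g' / g t ^ Suc n)"
proof (rule DERIV_imp_deriv)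
  have "((\<lambda>t. h (g t) / g t ^ n) has_field_derivative
      (h' * g' * g t ^ n - h (g t) * (of_nat n * (g' * g t ^ (n - Suc 0)))) / (g t ^ n * g t ^ n)) (at t)"
    using g(2) by (auto intro!: derivative_eq_intros g(1) DERIV_chain2[OF h g(1)])
  also have "(h' * g' * g t ^ n - h (g t) * (of_nat n * (g' * g t ^ (n - Suc 0)))) / (g t ^ n * g t ^ n) =
      h' * g' / g t ^ n - of_nat n * (h (g t) * g' / g t ^ Suc n)"
    using g(2) by (cases n) (simp_all add: field_simps)
  finally show "((\<lambda>t. h (g t) / g t ^ n) has_field_derivative
      h' * g' / g t ^ n - of_nat n * (h (g t) * g' / g t ^ Suc n)) (at t)" .
qed

lemma residue_comp_over_power_Suc:
  assumes S: "open S" "z \<in> S"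
    and g: "g holomorphic_on S" "\<And>t. t \<in> S - {z} \<Longrightarrow> g t \<noteq> 0"
    and h: "h holomorphic_on U" "open U" "g ` S \<subseteq> U"
  shows "residue (\<lambda>t. deriv h (g t) * deriv g t / g t ^ n) z =
    of_nat n * residue (\<lambda>t. h (g t) * deriv g t / g t ^ Suc n) z"
proof -
  define K where "K h m t = h (g t) * deriv g t / g t ^ m" for h m t
  have comp: "(\<lambda>t. f (g t)) holomorphic_on S - {z}" if "f holomorphic_on U" for f
    using holomorphic_on_compose_gen[OF holomorphic_on_subset[OF g(1), of "S - {z}"] that] h(3)
    by (auto simp: o_def)
  have K: "K f m holomorphic_on S - {z}" if "f holomorphic_on U" for f m
    unfolding K_def
    by (intro holomorphic_intros comp[OF that] holomorphic_on_subset[OF g(1)]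
        holomorphic_on_subset[OF holomorphic_deriv[OF g(1) S(1)]]) (auto simp: g(2))
  have "residue (\<lambda>t. K (deriv h) n t - of_nat n * K h (Suc n) t) z =
      residue (deriv (\<lambda>t. h (g t) / g t ^ n)) z"
  proof (rule residue_cong)
    have "K (deriv h) n t - of_nat n * K h (Suc n) t = deriv (\<lambda>t. h (g t) / g t ^ n) t"
      if t: "t \<in> S - {z}" for t
      unfolding K_def
      by (rule deriv_comp_over_power[symmetric])
         (use t g(2) h(3) in
           \<open>auto intro!: holomorphic_derivI[OF g(1) S(1)] holomorphic_derivI[OF h(1,2)]\<close>)
    then show "\<forall>\<^sub>F t in at z. K (deriv h) n t - of_nat n * K h (Suc n) t =
        deriv (\<lambda>t. h (g t) / g t ^ n) t"
      using S by (auto simp: eventually_at_topological)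
  qed simp
  also have "\<dots> = 0"
    by (rule residue_deriv_eq_0[OF S])
       (intro holomorphic_intros comp[OF h(1)] holomorphic_on_subset[OF g(1)], auto simp: g(2))
  finally have "residue (K (deriv h) n) z - of_nat n * residue (K h (Suc n)) z = 0"
    by (simp add: residue_diff[OF S] residue_lmul[OF S] holomorphic_intros K holomorphic_deriv h)
  then show ?thesis by (simp add: K_def[abs_def])
qed

lemma residue_comp_over_power_simple_zero:
  assumes S: "open S" "z \<in> S"
    and g: "g holomorphic_on S" "g z = 0" "deriv g z \<noteq> 0" "\<And>t. t \<in> S - {z} \<Longrightarrow> g t \<noteq> 0"
    and h: "h holomorphic_on U" "open U" "g ` S \<subseteq> U"
  shows "residue (\<lambda>t. h (g t) * deriv g t / g t ^ Suc n) z = (deriv ^^ n) h 0 / fact n"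
  using h(1)
proof (induction n arbitrary: h)
  case (0 h)
  have "h \<circ> g holomorphic_on S"
    using g(1) 0 h(3) by (rule holomorphic_on_compose_gen)
  then show ?case
    using residue_comp_over_simple_zero[OF S g, of "h \<circ> g"] by (simp add: g(2))
next
  case (Suc n h)
  have "of_nat (Suc n) * residue (\<lambda>t. h (g t) * deriv g t / g t ^ Suc (Suc n)) z =
      residue (\<lambda>t. deriv h (g t) * deriv g t / g t ^ Suc n) z"
    by (rule residue_comp_over_power_Suc[OF S g(1,4) Suc.prems h(2,3), symmetric])
  also have "\<dots> = (deriv ^^ Suc n) h 0 / fact n"
    unfolding Suc.IH[OF holomorphic_deriv[OF Suc.prems h(2)]] funpow_Suc_right by simp
  finally have "residue (\<lambda>t. h (g t) * deriv g t / g t ^ Suc (Suc n)) z =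
      (deriv ^^ Suc n) h 0 / (of_nat (Suc n) * fact n)"
    by (simp add: field_simps del: of_nat_Suc power_Suc funpow.simps)
  then show ?case by (simp only: fact_Suc)
qed

section \<open>Contour integrals in the variable \<open>t\<close>\<close>

lemma cos_eq_0_strip:
  assumes "cos (t::complex) = 0" "- (pi/2) < Re t" "Re t < 3 * pi/2"
  shows "t = of_real (pi/2)"
proof -
  obtain n :: int where n: "t = of_real (of_int n * pi) + of_real pi / 2"
    using assms(1) unfolding cos_eq_0 by (auto simp: algebra_simps)
  then have "- 1 * pi < of_int n * pi" "of_int n * pi < 1 * pi"
    using assms(2,3) by simp_all
  then have "- 1 < real_of_int n" "real_of_int n < 1"
    by (simp_all only: mult_less_cancel_right_pos pi_gt_zero)
  then have "n = 0" by linarith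
  then show ?thesis using n by simp
qed

lemma cos_nonzero_strip:
  assumes "pi/2 < Re t" "Re t < 3 * pi/2"
  shows "cos (t::complex) \<noteq> 0"
proof
  assume "cos t = 0"
  then have "t = of_real (pi/2)"
    by (rule cos_eq_0_strip) (use assms pi_gt_zero in linarith)+
  then have "Re t = pi/2" by (simp only: Re_complex_of_real)
  then show False using assms by simp
qed

lemma path_image_rectpath_segments:
  "path_image (rectpath (Complex x0 y0) (Complex x1 y1)) =
     closed_segment (Complex x0 y0) (Complex x1 y0) \<union> closed_segment (Complex x1 y0) (Complex x1 y1) \<union>
     closed_segment (Complex x1 y1) (Complex x0 y1) \<union> closed_segment (Complex x0 y1) (Complex x0 y0)"
  by (simp add: rectpath_def Let_def path_image_join Un_assoc)

abbreviation segment_integral :: "complex \<Rightarrow> complex \<Rightarrow> (complex \<Rightarrow> complex) \<Rightarrow> complex" where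
  "segment_integral z w f \<equiv> contour_integral (linepath z w) f"

lemma contour_integral_rectpath:
  assumes "continuous_on (path_image (rectpath (Complex x0 y0) (Complex x1 y1))) f"
  shows "contour_integral (rectpath (Complex x0 y0) (Complex x1 y1)) f =
    segment_integral (Complex x0 y0) (Complex x1 y0) f +
    segment_integral (Complex x1 y0) (Complex x1 y1) f +
    segment_integral (Complex x1 y1) (Complex x0 y1) f +
    segment_integral (Complex x0 y1) (Complex x0 y0) f"
proof -
  have "f contour_integrable_on linepath (Complex x0 y0) (Complex x1 y0)"
    "f contour_integrable_on linepath (Complex x1 y0) (Complex x1 y1)"
    "f contour_integrable_on linepath (Complex x1 y1) (Complex x0 y1)"
    "f contour_integrable_on linepath (Complex x0 y1) (Complex x0 y0)"
    using assms unfolding path_image_rectpath_segments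
    by (auto intro!: contour_integrable_continuous_linepath elim: continuous_on_subset)
  then show ?thesis by (simp add: rectpath_def Let_def)
qed

lemma contour_integral_vertical_shift:
  assumes hol: "f holomorphic_on cbox (Complex a p) (Complex b q)" and "a \<le> b" "p \<le> q"
  shows "segment_integral (Complex a p) (Complex a q) f =
    segment_integral (Complex a p) (Complex b p) f +
    segment_integral (Complex b p) (Complex b q) f -
    segment_integral (Complex a q) (Complex b q) f"
proof -
  let ?\<gamma> = "rectpath (Complex a p) (Complex b q)"
  have sub: "path_image ?\<gamma> \<subseteq> cbox (Complex a p) (Complex b q)"
    using assms by (intro path_image_rectpath_subset_cbox) auto
  have cont: "continuous_on (path_image ?\<gamma>) f"
    using holomorphic_on_imp_continuous_on[OF hol] sub by (rule continuous_on_subset)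
  have "contour_integral ?\<gamma> f = 0"
    by (rule contour_integral_unique, rule Cauchy_theorem_convex_simple[OF hol]) (use sub in auto)
  moreover have "segment_integral z w f = - segment_integral w z f"
    if "closed_segment z w \<subseteq> path_image ?\<gamma>" for z w
    using contour_integral_reverse_linepath[OF continuous_on_subset[OF cont that]] .
  then have
    "segment_integral (Complex b q) (Complex a q) f = - segment_integral (Complex a q) (Complex b q) f"
    "segment_integral (Complex a q) (Complex a p) f = - segment_integral (Complex a p) (Complex a q) f"
    by (simp_all only: path_image_rectpath_segments) auto
  ultimately show ?thesis using contour_integral_rectpath[OF cont] by (simp add: algebra_simps)
qed

lemma contour_integral_odd_linepath:
  assumes "continuous_on (closed_segment a (- a)) f" "\<And>z. f (- z) = - f z"
  shows "segment_integral a (- a) f = 0"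
proof -
  have "segment_integral (- a) a f = contour_integral (uminus \<circ> linepath a (- a)) f"
    by (rule arg_cong2[where f = contour_integral]) (auto simp: linepath_def fun_eq_iff algebra_simps)
  also have "\<dots> = segment_integral a (- a) f"
    by (simp add: contour_integral_negatepath assms(2) contour_integral_neg)
  finally show ?thesis
    using contour_integral_reverse_linepath[OF assms(1)] by simp
qed

lemma Im_contour_integral_cnj_symmetric:
  assumes cont: "continuous_on (closed_segment (Complex x (- y)) (Complex x y)) f"
    and cnj: "\<And>t. t \<in> closed_segment (Complex x 0) (Complex x y) \<Longrightarrow> f (cnj t) = cnj (f t)"
    and "0 \<le> y"
  shows "Im (segment_integral (Complex x (- y)) (Complex x y) f) =
    2 * Im (segment_integral (Complex x 0) (Complex x y) f)"
proof -
  let ?upper = "linepath (Complex x 0) (Complex x y)"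
  have mid: "Complex x 0 \<in> closed_segment (Complex x (- y)) (Complex x y)"
    using assms(3) by (simp add: closed_segment_same_Re closed_segment_eq_real_ivl)
  have upper: "continuous_on (closed_segment (Complex x 0) (Complex x y)) f"
    using subset_closed_segment mid ends_in_segment(2) by (intro continuous_on_subset[OF cont]) blast
  have "segment_integral (Complex x (- y)) (Complex x 0) f =
      contour_integral (cnj \<circ> linepath (Complex x y) (Complex x 0)) f"
    by (rule arg_cong2[where f = contour_integral])
       (auto simp: linepath_def fun_eq_iff complex_eq_iff)
  also have "\<dots> = cnj (segment_integral (Complex x y) (Complex x 0) (cnj \<circ> f \<circ> cnj))"
    by (rule contour_integral_cnj) simp
  also have "segment_integral (Complex x y) (Complex x 0) (cnj \<circ> f \<circ> cnj) =
      segment_integral (Complex x y) (Complex x 0) f"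
    by (rule contour_integral_eq) (simp add: cnj closed_segment_commute)
  also have "\<dots> = - contour_integral ?upper f"
    using upper by (intro contour_integral_reverse_linepath) (simp add: closed_segment_commute)
  finally have "Im (segment_integral (Complex x (- y)) (Complex x 0) f) =
      Im (contour_integral ?upper f)"
    by simp
  then show ?thesis
    using contour_integral_split_linepath[OF cont mid] by simp
qed

lemma Im_contour_integral_real_segment:
  assumes "\<And>t. t \<in> closed_segment (Complex x 0) (Complex y 0) \<Longrightarrow> f (cnj t) = cnj (f t)"
  shows "Im (segment_integral (Complex x 0) (Complex y 0) f) = 0"
proof -
  let ?\<gamma> = "linepath (Complex x 0) (Complex y 0)"
  have "contour_integral ?\<gamma> f = contour_integral (cnj \<circ> ?\<gamma>) f"
    by (rule arg_cong2[where f = contour_integral]) (auto simp: linepath_def fun_eq_iff complex_eq_iff)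
  also have "\<dots> = cnj (contour_integral ?\<gamma> (cnj \<circ> f \<circ> cnj))"
    by (rule contour_integral_cnj) simp
  also have "contour_integral ?\<gamma> (cnj \<circ> f \<circ> cnj) = contour_integral ?\<gamma> f"
    by (rule contour_integral_eq) (simp add: assms)
  finally show ?thesis by (simp add: complex_eq_iff)
qed

lemma Im_contour_integral_vertical_ge:
  assumes "a < b" and cont: "continuous_on (closed_segment (Complex c a) (Complex c b)) f"
    and \<phi>: "(\<phi> has_integral I) {a..b}" "\<And>s. s \<in> {a..b} \<Longrightarrow> \<phi> s \<le> Re (f (Complex c s))"
  shows "I \<le> Im (segment_integral (Complex c a) (Complex c b) f)"
proof -
  let ?J = "segment_integral (Complex c a) (Complex c b) f"
  have "(f has_contour_integral ?J) (linepath (Complex c a) (Complex c b))"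
    using cont by (intro has_contour_integral_integral contour_integrable_continuous_linepath)
  then have "((\<lambda>s. f (Complex c s)) has_integral - \<i> * ?J) {a..b}"
    using assms(1) by (simp add: has_contour_integral_linepath_same_Re_iff)
  from has_integral_linear[OF this bounded_linear_Re]
  have "((\<lambda>s. Re (f (Complex c s))) has_integral Im ?J) {a..b}"
    by (simp add: o_def)
  with \<phi>(1) show ?thesis by (rule has_integral_le) (rule \<phi>(2))
qed

definition cos_kernel :: "(complex \<Rightarrow> complex) \<Rightarrow> nat \<Rightarrow> complex \<Rightarrow> complex" where
  "cos_kernel F n t = F t * sin t / (- cos t) ^ Suc n"

definition cos_descent :: "(complex \<Rightarrow> complex) \<Rightarrow> complex \<Rightarrow> complex" where
  "cos_descent F z = F (Arccos (- z))"

lemma cos_descent_minus_cos: "\<lbrakk>0 < Re t; Re t < pi\<rbrakk> \<Longrightarrow> cos_descent F (- cos t) = F t"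
  by (simp add: cos_descent_def Arccos_cos)

lemma cos_descent_of_real: "\<bar>x\<bar> \<le> 1 \<Longrightarrow> cos_descent F (of_real x) = F (of_real (arccos (- x)))"
  by (simp add: cos_descent_def of_real_arccos)

lemma cos_kernel_holomorphic:
  assumes "F holomorphic_on S" "\<And>t. t \<in> S \<Longrightarrow> cos t \<noteq> 0"
  shows "cos_kernel F n holomorphic_on S"
  unfolding cos_kernel_def[abs_def] using assms by (intro holomorphic_intros) auto

lemma cmod_cos_kernel_le:
  assumes "cmod (F t) \<le> A" "cmod (sin t) \<le> s" "0 < c" "c \<le> cmod (cos t)"
  shows "cmod (cos_kernel F n t) \<le> A * s / c ^ Suc n"
proof -
  have "0 \<le> A" "0 \<le> s" using assms(1,2) norm_ge_zero order_trans by blast+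
  then show ?thesis
    unfolding cos_kernel_def norm_divide norm_mult norm_power norm_minus_cancel
    using assms by (intro frac_le mult_mono power_mono) auto
qed

lemma Arccos_minus_holomorphic: "(\<lambda>z. Arccos (- z)) holomorphic_on ball 0 1"
proof -
  have "Arccos holomorphic_on ball 0 1"
    using abs_Re_le_cmod by (intro holomorphic_on_Arccos) (force intro: le_less_trans)
  then have "Arccos \<circ> uminus holomorphic_on ball 0 1"
    by (intro holomorphic_on_compose_gen[of uminus _ Arccos "ball 0 1"]) (auto intro: holomorphic_intros)
  then show ?thesis by (simp add: o_def)
qed

definition horizontal_bound :: "(complex \<Rightarrow> complex) \<Rightarrow> real \<Rightarrow> (real \<Rightarrow> real) \<Rightarrow> bool" where
  "horizontal_bound F b M \<longleftrightarrow>
     (\<forall>\<^sub>F R in at_top. \<forall>t. 0 \<le> Re t \<longrightarrow> Re t \<le> b \<longrightarrow> Im t = R \<longrightarrow> cmod (F t) \<le> M R)"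

lemma horizontal_bound_antimono: "\<lbrakk>horizontal_bound F b M; a \<le> b\<rbrakk> \<Longrightarrow> horizontal_bound F a M"
  unfolding horizontal_bound_def by (elim eventually_mono) auto

locale even_strip_function =
  fixes F :: "complex \<Rightarrow> complex" and T :: "complex set" and a :: real
  assumes holomorphic: "F holomorphic_on T" and open_domain: "open T"
    and strip: "\<And>t. \<lbrakk>0 \<le> Re t; Re t \<le> a\<rbrakk> \<Longrightarrow> t \<in> T"
    and disc: "\<And>t. \<lbrakk>0 < Re t; Re t < pi; cmod (cos t) < 1\<rbrakk> \<Longrightarrow> t \<in> T"
    and even: "\<And>t. F (- t) = F t"
    and cnj: "\<And>t. t \<noteq> 0 \<Longrightarrow> F (cnj t) = cnj (F t)"
    and a_bounds: "pi/2 < a" "a \<le> pi"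
begin

lemma cos_descent_holomorphic: "cos_descent F holomorphic_on ball 0 1"
proof -
  have "Arccos (- z) \<in> T" if "z \<in> ball 0 1" for z
    using Arccos_bounds[of "- z"] abs_Re_le_cmod[of z] that by (intro disc) auto
  then have "F \<circ> (\<lambda>z. Arccos (- z)) holomorphic_on ball 0 1"
    by (intro holomorphic_on_compose_gen[OF Arccos_minus_holomorphic holomorphic]) auto
  then show ?thesis by (simp add: o_def cos_descent_def[abs_def])
qed

lemma cos_kernel_cnj: "t \<noteq> 0 \<Longrightarrow> cos_kernel F n (cnj t) = cnj (cos_kernel F n t)"
  by (simp add: cos_kernel_def cnj cnj_sin cnj_cos)

lemma cos_kernel_odd: "cos_kernel F n (- t) = - cos_kernel F n t"
  by (simp add: cos_kernel_def even)

lemma residue_cos_kernel: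
  "residue (cos_kernel F n) (of_real (pi/2)) = (deriv ^^ n) (cos_descent F) 0 / fact n"
proof -
  let ?z = "of_real (pi/2) :: complex"
  define S where "S = {t. cmod (cos t) < 1 \<and> 0 < Re t \<and> Re t < pi}"
  have S: "open S" "?z \<in> S"
    unfolding S_def
    by (intro open_Collect_conj open_Collect_less continuous_intros) (simp flip: cos_of_real)
  have deriv_cos: "deriv (\<lambda>t. - cos t) t = sin t" for t :: complex
    by (rule DERIV_imp_deriv) (auto intro!: derivative_eq_intros)
  have "residue (cos_kernel F n) ?z =
      residue (\<lambda>t. cos_descent F (- cos t) * deriv (\<lambda>t. - cos t) t / (- cos t) ^ Suc n) ?z"
    using S by (intro residue_cong)
      (auto simp: eventually_at_topological cos_kernel_def deriv_cos cos_descent_minus_cos S_def)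
  also have "\<dots> = (deriv ^^ n) (cos_descent F) 0 / fact n"
  proof (rule residue_comp_over_power_simple_zero[OF S _ _ _ _ cos_descent_holomorphic open_ball])
    show "- cos ?z = 0" by (simp flip: cos_of_real)
    show "deriv (\<lambda>t. - cos t) ?z \<noteq> 0" unfolding deriv_cos by (simp flip: sin_of_real)
    show "- cos t \<noteq> 0" if "t \<in> S - {?z}" for t
      using that cos_eq_0_strip[of t] by (auto simp: S_def)
  qed (auto simp: S_def intro!: holomorphic_intros)
  finally show ?thesis .
qed

lemma rectangle_integral_cos_kernel:
  assumes "0 < R"
  shows "contour_integral (rectpath (Complex 0 (- R)) (Complex a R)) (cos_kernel F n) =
    2 * pi * \<i> * ((deriv ^^ n) (cos_descent F) 0 / fact n)"
proof -
  let ?z = "of_real (pi/2) :: complex"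
  let ?K = "cbox (Complex 0 (- R)) (Complex a R)"
  let ?\<gamma> = "rectpath (Complex 0 (- R)) (Complex a R)"
  have inside: "?z \<in> box (Complex 0 (- R)) (Complex a R)"
    using a_bounds assms by (simp add: in_box_complex_iff)
  define T' where "T' = T \<inter> {t. - (pi/2) < Re t} \<inter> {t. Re t < 3 * pi/2}"
  define S where "S = connected_component_set T' ?z"
  have "open T'"
    unfolding T'_def by (intro open_Int open_domain open_Collect_less continuous_intros)
  then have S: "open S" "connected S" "S \<subseteq> T'"
    by (simp_all add: S_def open_connected_component connected_component_subset)
  have "?K \<subseteq> T'"
    using strip a_bounds by (auto simp: T'_def in_cbox_complex_iff)
  then have K: "?K \<subseteq> S"
    unfolding S_def using inside box_subset_cbox
    by (intro connected_component_maximal) (auto intro!: convex_connected convex_box)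
  have hol: "cos_kernel F n holomorphic_on S - {?z}"
  proof (rule cos_kernel_holomorphic)
    show "F holomorphic_on S - {?z}"
      using S(3) by (intro holomorphic_on_subset[OF holomorphic]) (auto simp: T'_def)
    show "cos t \<noteq> 0" if "t \<in> S - {?z}" for t
      using that S(3) cos_eq_0_strip[of t] by (auto simp: T'_def)
  qed
  have \<gamma>: "path_image ?\<gamma> \<subseteq> S - {?z}"
    using path_image_rectpath_cbox_minus_box[of "Complex 0 (- R)" "Complex a R"] a_bounds assms K inside by auto
  have "contour_integral ?\<gamma> (cos_kernel F n) =
      2 * pi * \<i> * (\<Sum>p\<in>{?z}. winding_number ?\<gamma> p * residue (cos_kernel F n) p)"
    by (rule Residue_theorem[OF S(1,2) _ hol _ _ \<gamma>])
       (use K a_bounds assms in \<open>auto intro!: winding_number_rectpath_outside\<close>)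
  then show ?thesis
    using winding_number_rectpath[OF inside] residue_cos_kernel by simp
qed

lemma cos_kernel_continuous_on_rectangle:
  assumes "0 < R"
  shows "continuous_on (path_image (rectpath (Complex 0 (- R)) (Complex a R))) (cos_kernel F n)"
proof (intro holomorphic_on_imp_continuous_on cos_kernel_holomorphic
    holomorphic_on_subset[OF holomorphic])
  show "path_image (rectpath (Complex 0 (- R)) (Complex a R)) \<subseteq> T"
    using strip a_bounds assms by (auto simp: path_image_rectpath)
  fix t assume t: "t \<in> path_image (rectpath (Complex 0 (- R)) (Complex a R))"
  show "cos t \<noteq> 0"
  proof
    assume "cos t = 0"
    then have "t = of_real (pi/2)"
      using t a_bounds assms by (intro cos_eq_0_strip) (auto simp: path_image_rectpath)
    then have "Re t = pi/2" "Im t = 0" by (simp_all only: Re_complex_of_real Im_complex_of_real)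
    then show False using t a_bounds assms by (auto simp: path_image_rectpath)
  qed
qed

lemma horizontal_side_integral_bound:
  assumes R: "0 < R"
    and M: "\<And>t. \<lbrakk>0 \<le> Re t; Re t \<le> a; Im t = R\<rbrakk> \<Longrightarrow> cmod (cos_kernel F n t) \<le> M"
    and y: "\<bar>y\<bar> = R" and x: "x \<in> {0..a}" "x' \<in> {0..a}"
    and cont: "continuous_on (closed_segment (Complex x y) (Complex x' y)) (cos_kernel F n)"
  shows "cmod (segment_integral (Complex x y) (Complex x' y) (cos_kernel F n)) \<le> M * \<bar>x' - x\<bar>"
proof -
  have "0 \<le> M" using M[of "Complex 0 R"] a_bounds by (auto intro: order_trans[OF norm_ge_zero])
  have "cmod (cos_kernel F n t) \<le> M" if "t \<in> closed_segment (Complex x y) (Complex x' y)" for t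
  proof -
    have t: "0 \<le> Re t" "Re t \<le> a" "Im t = y"
      using that x by (auto simp: closed_segment_same_Im closed_segment_eq_real_ivl split: if_splits)
    then have "cmod (cos_kernel F n (cnj t)) = cmod (cos_kernel F n t)"
      using y R by (subst cos_kernel_cnj) auto
    then show ?thesis
      using M[of t] M[of "cnj t"] t y by (cases "0 \<le> y") auto
  qed
  then have "cmod (segment_integral (Complex x y) (Complex x' y) (cos_kernel F n)) \<le>
      M * cmod (Complex x' y - Complex x y)"
    using cont \<open>0 \<le> M\<close> by (intro contour_integral_bound_linepath contour_integrable_continuous_linepath)
  then show ?thesis by (simp add: complex_diff cmod_def)
qed

lemma right_side_integral_bound:
  assumes R: "0 < R"
    and M: "\<And>t. \<lbrakk>0 \<le> Re t; Re t \<le> a; Im t = R\<rbrakk> \<Longrightarrow> cmod (cos_kernel F n t) \<le> M"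
  shows "\<bar>pi * Re ((deriv ^^ n) (cos_descent F) 0 / fact n) -
      Im (segment_integral (Complex a 0) (Complex a R) (cos_kernel F n))\<bar> \<le> pi * M"
proof -
  let ?I = "\<lambda>z w. segment_integral z w (cos_kernel F n)"
  define c where "c = (deriv ^^ n) (cos_descent F) 0 / fact n"
  note cont = cos_kernel_continuous_on_rectangle[OF R, of n]
  note cont_side = continuous_on_subset[OF cont[unfolded path_image_rectpath_segments]]
  have left: "?I (Complex 0 R) (Complex 0 (- R)) = 0"
    using contour_integral_odd_linepath[of "Complex 0 R" "cos_kernel F n"] cont_side cos_kernel_odd
    by (simp add: complex_minus)
  have right: "Im (?I (Complex a (- R)) (Complex a R)) = 2 * Im (?I (Complex a 0) (Complex a R))"
  proof (rule Im_contour_integral_cnj_symmetric[OF cont_side])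
    fix t assume "t \<in> closed_segment (Complex a 0) (Complex a R)"
    then have "t \<noteq> 0" using a_bounds by (auto simp: closed_segment_same_Re)
    then show "cos_kernel F n (cnj t) = cnj (cos_kernel F n t)" by (rule cos_kernel_cnj)
  qed (use R in auto)
  have "cmod (?I (Complex 0 (- R)) (Complex a (- R))) \<le> M * \<bar>a - 0\<bar>"
    by (rule horizontal_side_integral_bound[OF R M _ _ _ cont_side]) (use a_bounds R in auto)
  moreover have "cmod (?I (Complex a R) (Complex 0 R)) \<le> M * \<bar>0 - a\<bar>"
    by (rule horizontal_side_integral_bound[OF R M _ _ _ cont_side]) (use a_bounds R in auto)
  ultimately have horizontal: "cmod (?I (Complex 0 (- R)) (Complex a (- R))) \<le> M * a"
    "cmod (?I (Complex a R) (Complex 0 R)) \<le> M * a"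
    using a_bounds by simp_all
  have "2 * pi * \<i> * c - ?I (Complex a (- R)) (Complex a R) =
      ?I (Complex 0 (- R)) (Complex a (- R)) + ?I (Complex a R) (Complex 0 R)"
    using rectangle_integral_cos_kernel[OF R, of n, folded c_def] contour_integral_rectpath[OF cont] left
    by (simp add: algebra_simps)
  then have "cmod (2 * pi * \<i> * c - ?I (Complex a (- R)) (Complex a R)) \<le> M * a + M * a"
    using norm_triangle_mono[OF horizontal] by simp
  moreover have "Im (2 * pi * \<i> * c) = 2 * pi * Re c" by simp
  ultimately have "\<bar>2 * pi * Re c - Im (?I (Complex a (- R)) (Complex a R))\<bar> \<le> M * a + M * a"
    using abs_Im_le_cmod[of "2 * pi * \<i> * c - ?I (Complex a (- R)) (Complex a R)"] by simp
  moreover have "0 \<le> M" using M[of "Complex 0 R"] a_bounds by (auto intro: order_trans[OF norm_ge_zero])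
  then have "M * a \<le> M * pi" using a_bounds by (intro mult_left_mono) auto
  ultimately show ?thesis unfolding right c_def[symmetric] by (simp add: abs_le_iff algebra_simps)
qed

theorem Taylor_coeff_nonneg:
  assumes bound: "horizontal_bound (cos_kernel F n) a M"
    and M: "(M \<longlongrightarrow> 0) at_top"
    and side: "\<forall>\<^sub>F R in at_top. - e R \<le>
      Im (segment_integral (Complex a 0) (Complex a R) (cos_kernel F n))"
    and e: "(e \<longlongrightarrow> 0) at_top"
  shows "0 \<le> Re ((deriv ^^ n) (cos_descent F) 0)"
proof -
  let ?c = "(deriv ^^ n) (cos_descent F) 0 / fact n"
  have "\<forall>\<^sub>F R in at_top. - e R - pi * M R \<le> pi * Re ?c"
    using bound[unfolded horizontal_bound_def] side eventually_gt_at_top[of 0]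
  proof eventually_elim
    case (elim R)
    then have "\<bar>pi * Re ?c - Im (segment_integral (Complex a 0) (Complex a R) (cos_kernel F n))\<bar>
        \<le> pi * M R"
      by (intro right_side_integral_bound) auto
    then show ?case using elim(2) by linarith
  qed
  moreover have "((\<lambda>R. - e R - pi * M R) \<longlongrightarrow> - 0 - pi * 0) at_top"
    by (intro tendsto_intros M e)
  ultimately have "- 0 - pi * 0 \<le> pi * Re ?c"
    by (intro tendsto_upperbound[of _ _ at_top]) auto
  then have "0 \<le> Re ?c" using mult_le_cancel_left_pos[of pi 0 "Re ?c"] by simp
  then show ?thesis by (simp add: Re_divide_fact pos_le_divide_eq)
qed

theorem absolutely_monotone_01:
  assumes "\<And>n. 0 \<le> Re ((deriv ^^ n) (cos_descent F) 0)"
    and "\<And>x. x \<in> {0..<1} \<Longrightarrow> F (of_real (arccos (- x))) = of_real (f x)"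
    and "continuous_on {0..1} f"
  shows "absolutely_monotone_01 f"
  by (rule absolutely_monotone_01_of_Taylor_coeffs[OF cos_descent_holomorphic])
     (use assms in \<open>simp_all add: cos_descent_of_real\<close>)

end

section \<open>Hyperbolic and trigonometric estimates\<close>

lemma norm_triangle_mono_diff: "\<lbrakk>norm a \<le> r; norm b \<le> s\<rbrakk> \<Longrightarrow> norm (a - b) \<le> r + s"
  by (rule norm_triangle_le_diff) simp

lemma norm_mult_mono:
  fixes a b :: "'a::real_normed_div_algebra"
  shows "\<lbrakk>norm a \<le> r; norm b \<le> s\<rbrakk> \<Longrightarrow> norm (a * b) \<le> r * s"
  unfolding norm_mult using order_trans[OF norm_ge_zero, of a r] by (intro mult_mono) auto

lemma norm_power_mono:
  fixes a :: "'a::real_normed_div_algebra"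
  shows "norm a \<le> r \<Longrightarrow> norm (a ^ n) \<le> r ^ n"
  unfolding norm_power by (rule power_mono) simp_all

lemma cmod_le_of_Re_Im:
  assumes "\<bar>Re z\<bar> \<le> a" "\<bar>Im z\<bar> \<le> b" "a\<^sup>2 + b\<^sup>2 \<le> r\<^sup>2" "0 \<le> r"
  shows "cmod z \<le> r"
proof -
  have "(Re z)\<^sup>2 \<le> a\<^sup>2" "(Im z)\<^sup>2 \<le> b\<^sup>2"
    using assms by (auto intro!: abs_le_square_iff[THEN iffD1])
  then have "(cmod z)\<^sup>2 \<le> r\<^sup>2" using assms(3) by (simp add: cmod_power2)
  then show ?thesis using assms(4) by (rule power2_le_imp_le)
qed

lemma sinh_ge_self: "0 \<le> x \<Longrightarrow> x \<le> sinh (x::real)"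
  using deriv_nonneg_imp_mono[of 0 x "\<lambda>x. sinh x - x" "\<lambda>x. cosh x - 1"]
  by (force intro!: derivative_eq_intros simp: cosh_real_ge_1)

lemma cosh_ge_quadratic: "0 \<le> x \<Longrightarrow> 1 + x\<^sup>2 / 2 \<le> cosh (x::real)"
  using deriv_nonneg_imp_mono[of 0 x "\<lambda>x. cosh x - (1 + x\<^sup>2 / 2)" "\<lambda>x. sinh x - x"]
  by (force intro!: derivative_eq_intros simp: sinh_ge_self)

lemma sinh_ge_cubic: "0 \<le> x \<Longrightarrow> x + x ^ 3 / 6 \<le> sinh (x::real)"
  using deriv_nonneg_imp_mono[of 0 x "\<lambda>x. sinh x - (x + x ^ 3 / 6)" "\<lambda>x. cosh x - (1 + x\<^sup>2 / 2)"]
  by (force intro!: derivative_eq_intros simp: cosh_ge_quadratic)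

lemma sinh_le_self_cosh: "0 \<le> x \<Longrightarrow> sinh x \<le> x * cosh (x::real)"
  using deriv_nonneg_imp_mono[of 0 x "\<lambda>x. x * cosh x - sinh x" "\<lambda>x. x * sinh x"]
  by (force intro!: derivative_eq_intros)

lemma sinh_le_half_one_plus_cosh:
  fixes x :: real
  assumes "0 \<le> x"
  shows "sinh x \<le> x / 2 * (1 + cosh x)"
proof -
  have "sinh (2 * (x/2)) = 2 * cosh (x/2) * sinh (x/2)" "1 + cosh (2 * (x/2)) = 2 * (cosh (x/2))\<^sup>2"
    by (simp_all only: sinh_double cosh_double_cosh) simp_all
  moreover have "cosh (x/2) * sinh (x/2) \<le> cosh (x/2) * (x/2 * cosh (x/2))"
    using assms sinh_le_self_cosh[of "x/2"] by (intro mult_left_mono) auto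
  ultimately show ?thesis by (simp add: power2_eq_square algebra_simps)
qed

lemma cos_Complex: "cos (Complex x y) = Complex (cos x * cosh y) (- sin x * sinh y)"
  and sin_Complex: "sin (Complex x y) = Complex (sin x * cosh y) (cos x * sinh y)"
  by (auto simp: complex_eq_iff Re_cos Im_cos Re_sin Im_sin cosh_def sinh_def field_simps)

lemma cos_right_line: "cos (Complex pi s) = of_real (- cosh s)"
  and sin_right_line: "sin (Complex pi s) = - \<i> * of_real (sinh s)"
  by (simp_all add: cos_Complex sin_Complex complex_eq_iff)

lemma cmod_cos_squared: "(cmod (cos t))\<^sup>2 = (cos (Re t))\<^sup>2 + (sinh (Im t))\<^sup>2"
  by (simp add: norm_cos_squared sinh_field_def exp_minus power_divide)

lemma cmod_sin_squared: "(cmod (sin t))\<^sup>2 = (sin (Re t))\<^sup>2 + (sinh (Im t))\<^sup>2"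
  by (simp add: sin_cos_eq[of t] cmod_cos_squared sin_cos_eq[of "Re t"])

lemma cmod_cos_ge: "\<bar>sinh (Im t)\<bar> \<le> cmod (cos t)"
  by (rule power2_le_imp_le) (simp_all add: cmod_cos_squared)

lemma cmod_cos_le: "cmod (cos t) \<le> cosh (Im t)"
  by (rule power2_le_imp_le) (simp_all add: cmod_cos_squared cosh_square_eq abs_square_le_1)

lemma cmod_sin_ge: "\<bar>sinh (Im t)\<bar> \<le> cmod (sin t)"
  by (rule power2_le_imp_le) (simp_all add: cmod_sin_squared)

lemma cmod_sin_le: "cmod (sin t) \<le> cosh (Im t)"
  by (rule power2_le_imp_le) (simp_all add: cmod_sin_squared cosh_square_eq abs_square_le_1)

lemma cmod_cos_kernel_horizontal_le:
  assumes "cmod (F t) \<le> A" "1 \<le> Im t" "k \<le> Suc n"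
  shows "cmod (cos_kernel F n t) \<le> A * cosh (Im t) / sinh (Im t) ^ k"
proof -
  have sinh: "1 \<le> sinh (Im t)" "sinh (Im t) \<le> cmod (cos t)"
    using sinh_ge_self[of "Im t"] cmod_cos_ge[of t] assms(2) by auto
  then have "cmod (cos_kernel F n t) \<le> A * cosh (Im t) / sinh (Im t) ^ Suc n"
    using assms(1,2) cmod_sin_le by (intro cmod_cos_kernel_le) auto
  also have "\<dots> \<le> A * cosh (Im t) / sinh (Im t) ^ k"
    using sinh assms(2,3) order_trans[OF norm_ge_zero assms(1)]
    by (intro divide_left_mono power_increasing mult_nonneg_nonneg mult_pos_pos zero_less_power) auto
  finally show ?thesis .
qed

lemma horizontal_bound_cos_kernel:
  assumes "horizontal_bound F b G" "k \<le> Suc n"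
  shows "horizontal_bound (cos_kernel F n) b (\<lambda>R. G R * cosh R / sinh R ^ k)"
  unfolding horizontal_bound_def
  using assms(1)[unfolded horizontal_bound_def] eventually_ge_at_top[of 1]
proof (eventually_elim, intro allI impI)
  fix R t
  assume "\<forall>t. 0 \<le> Re t \<longrightarrow> Re t \<le> b \<longrightarrow> Im t = R \<longrightarrow> cmod (F t) \<le> G R"
    and "1 \<le> R" "0 \<le> Re t" "Re t \<le> b" "Im t = R"
  then show "cmod (cos_kernel F n t) \<le> G R * cosh R / sinh R ^ k"
    using cmod_cos_kernel_horizontal_le[of F t "G R" k n] assms(2) by simp
qed

lemma Re_cos_kernel_right_line:
  "Re (cos_kernel F n (Complex pi s)) = Im (F (Complex pi s)) * sinh s / cosh s ^ Suc n"
proof -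
  have "cos_kernel F n (Complex pi s) = - \<i> * F (Complex pi s) * of_real (sinh s / cosh s ^ Suc n)"
    by (simp add: cos_kernel_def cos_right_line sin_right_line)
  then show ?thesis by (simp only:) (simp del: of_real_divide of_real_power power_Suc)
qed

section \<open>Numerator and denominator in the variable \<open>t\<close>\<close>

definition diff_quot :: "(complex \<Rightarrow> complex) \<Rightarrow> complex \<Rightarrow> complex" where
  "diff_quot f z = (if z = 0 then deriv f 0 else (f z - f 0) / z)"

lemma diff_quot_eq: "f z = f 0 + z * diff_quot f z"
  by (simp add: diff_quot_def)

lemma diff_quot_holomorphic: "f holomorphic_on UNIV \<Longrightarrow> diff_quot f holomorphic_on UNIV"
  using pole_lemma[of f UNIV 0] unfolding diff_quot_def[abs_def] diff_zero by simp

lemma deriv_even_at_0: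
  fixes f :: "complex \<Rightarrow> complex"
  assumes "f holomorphic_on UNIV" "\<And>z. f (- z) = f z"
  shows "deriv f 0 = 0"
proof -
  have f': "(f has_field_derivative deriv f 0) (at 0)"
    using assms(1) by (auto intro: holomorphic_derivI)
  then have "((\<lambda>z. f (- z)) has_field_derivative deriv f 0 * (-1)) (at 0)"
    by (intro DERIV_chain2[where f = f and g = uminus]) (auto intro!: derivative_eq_intros)
  then have "deriv f 0 = - deriv f 0"
    using f' by (simp add: assms(2) DERIV_unique)
  then show ?thesis by simp
qed

definition sinc :: "complex \<Rightarrow> complex" where "sinc = diff_quot sin"

definition sinc_tail :: "complex \<Rightarrow> complex" where "sinc_tail = diff_quot (diff_quot sinc)"

lemma sinc_holomorphic: "sinc holomorphic_on UNIV"
  unfolding sinc_def by (intro diff_quot_holomorphic holomorphic_intros)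

lemma sinc_tail_holomorphic: "sinc_tail holomorphic_on UNIV"
  unfolding sinc_tail_def by (intro diff_quot_holomorphic sinc_holomorphic)

lemma sin_eq_sinc: "sin z = z * sinc z"
  using diff_quot_eq[of sin z] by (simp add: sinc_def)

lemma sinc_0: "sinc 0 = 1"
  by (simp add: sinc_def diff_quot_def DERIV_imp_deriv[OF DERIV_sin])

lemma sinc_even: "sinc (- z) = sinc z"
  by (simp add: sinc_def diff_quot_def)

lemma sinc_eq_sinc_tail: "sinc z = 1 + z\<^sup>2 * sinc_tail z"
proof -
  have "diff_quot sinc 0 = 0"
    using deriv_even_at_0[OF sinc_holomorphic sinc_even] by (simp add: diff_quot_def)
  then have "diff_quot sinc z = z * sinc_tail z"
    using diff_quot_eq[of "diff_quot sinc" z] by (simp add: sinc_tail_def)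
  then show ?thesis
    using diff_quot_eq[of sinc z] by (simp add: sinc_0 power2_eq_square)
qed

lemma sin_eq_sinc_tail: "sin z = z + z ^ 3 * sinc_tail z"
  using sin_eq_sinc[of z] sinc_eq_sinc_tail[of z]
  by (simp add: algebra_simps power2_eq_square power3_eq_cube)

lemma one_minus_cos_eq_sinc: "1 - cos z = z\<^sup>2 / 2 * (sinc (z/2))\<^sup>2"
proof -
  have "1 - cos z = 2 * (sin (z/2))\<^sup>2"
    using cos_double_sin[of "z/2"] by simp
  then show ?thesis by (simp add: sin_eq_sinc[of "z/2"] power_mult_distrib power_divide)
qed

definition numer :: "complex \<Rightarrow> complex" where
  "numer t = - (t\<^sup>2 * cos t) + t * sin t - of_real (pi/2) * (1 - cos t)\<^sup>2"

definition denom :: "complex \<Rightarrow> complex" where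
  "denom t = t\<^sup>2 - t * sin t * cos t - of_real (pi/2) * (1 - cos t)\<^sup>2"

definition numer_red :: "complex \<Rightarrow> complex" where
  "numer_red t = sinc_tail t + (sinc (t/2))\<^sup>2 / 2 - of_real (pi/8) * sinc (t/2) ^ 4"

definition denom_red :: "complex \<Rightarrow> complex" where
  "denom_red t = - 4 * sinc_tail (2 * t) - of_real (pi/8) * sinc (t/2) ^ 4"

definition versine_sq_red :: "complex \<Rightarrow> complex" where
  "versine_sq_red t = sinc (t/2) ^ 4 / 4"

lemma versine_sq_eq: "(1 - cos t)\<^sup>2 = t ^ 4 * versine_sq_red t"
  by (simp add: one_minus_cos_eq_sinc versine_sq_red_def power_mult_distrib power_divide
      flip: power_mult)

lemma numer_eq: "numer t = t ^ 4 * numer_red t"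
proof -
  have cos: "cos t = 1 - t\<^sup>2 / 2 * (sinc (t/2))\<^sup>2"
    unfolding one_minus_cos_eq_sinc[symmetric] by simp
  have "- (t\<^sup>2 * cos t) + t * sin t = t ^ 4 * (sinc_tail t + (sinc (t/2))\<^sup>2 / 2)"
    unfolding sin_eq_sinc_tail[of t]
    by (subst cos) (simp add: algebra_simps power4_eq_xxxx power2_eq_square power3_eq_cube)
  then show ?thesis
    by (simp add: numer_def numer_red_def versine_sq_eq versine_sq_red_def algebra_simps)
qed

lemma denom_eq: "denom t = t ^ 4 * denom_red t"
proof -
  have "t * sin t * cos t = t * (sin (2 * t) / 2)"
    by (simp add: sin_double)
  also have "\<dots> = t\<^sup>2 + t ^ 4 * (4 * sinc_tail (2 * t))"
    unfolding sin_eq_sinc_tail[of "2 * t"]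
    by (simp add: algebra_simps power4_eq_xxxx power2_eq_square power3_eq_cube)
  finally show ?thesis
    by (simp add: denom_def denom_red_def versine_sq_eq versine_sq_red_def algebra_simps)
qed

lemma numer_red_holomorphic: "numer_red holomorphic_on UNIV"
  and denom_red_holomorphic: "denom_red holomorphic_on UNIV"
  and versine_sq_red_holomorphic: "versine_sq_red holomorphic_on UNIV"
proof -
  have "(\<lambda>t. sinc (t/2)) holomorphic_on UNIV" "(\<lambda>t. sinc_tail (2 * t)) holomorphic_on UNIV"
    using holomorphic_on_compose_gen[OF _ sinc_holomorphic, of "\<lambda>t. t/2" UNIV]
      holomorphic_on_compose_gen[OF _ sinc_tail_holomorphic, of "\<lambda>t. 2 * t" UNIV]
    by (simp_all add: o_def holomorphic_intros)
  then show "numer_red holomorphic_on UNIV" "denom_red holomorphic_on UNIV"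
    "versine_sq_red holomorphic_on UNIV"
    unfolding numer_red_def[abs_def] denom_red_def[abs_def] versine_sq_red_def[abs_def]
    by (intro holomorphic_intros sinc_tail_holomorphic; simp)+
qed

lemma numer_even: "numer (- t) = numer t" and denom_even: "denom (- t) = denom t"
  by (simp_all add: numer_def denom_def)

lemma numer_red_even: "numer_red (- t) = numer_red t" and denom_red_even: "denom_red (- t) = denom_red t"
  using numer_even[of t] denom_even[of t] by (cases "t = 0"; simp add: numer_eq denom_eq)+

lemma numer_cnj: "numer (cnj t) = cnj (numer t)" and denom_cnj: "denom (cnj t) = cnj (denom t)"
  by (simp_all add: numer_def denom_def cnj_sin cnj_cos)

lemma numer_red_cnj: "t \<noteq> 0 \<Longrightarrow> numer_red (cnj t) = cnj (numer_red t)"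
  and denom_red_cnj: "t \<noteq> 0 \<Longrightarrow> denom_red (cnj t) = cnj (denom_red t)"
  using numer_cnj[of t] denom_cnj[of t] by (simp_all add: numer_eq denom_eq)

lemma numer_of_real: "numer (of_real s) = of_real (- (s\<^sup>2 * cos s) + s * sin s - pi/2 * (1 - cos s)\<^sup>2)"
  and denom_of_real: "denom (of_real s) = of_real (s\<^sup>2 - s * sin s * cos s - pi/2 * (1 - cos s)\<^sup>2)"
  by (simp_all add: numer_def denom_def flip: cos_of_real sin_of_real)

lemma cmod_numer_le:
  assumes "cmod t \<le> r" "cmod (sin t) \<le> c" "cmod (cos t) \<le> c"
  shows "cmod (numer t) \<le> r\<^sup>2 * c + r * c + pi/2 * (1 + c)\<^sup>2"
proof -
  have "cmod (1 - cos t) \<le> 1 + c" using assms(3) by (intro norm_triangle_mono_diff) simp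
  then have "cmod (of_real (pi/2) * (1 - cos t)\<^sup>2) \<le> pi/2 * (1 + c)\<^sup>2"
    by (intro norm_mult_mono norm_power_mono) simp_all
  moreover have "cmod (- (t\<^sup>2 * cos t) + t * sin t) \<le> r\<^sup>2 * c + r * c"
    by (intro norm_triangle_mono norm_mult_mono norm_power_mono assms
        norm_minus_cancel[THEN eq_refl, THEN order_trans])
  ultimately show ?thesis unfolding numer_def by (rule norm_triangle_mono_diff[rotated])
qed

lemma arcsin_plus_half_pi: "\<lbrakk>- 1 \<le> x; x \<le> 1\<rbrakk> \<Longrightarrow> arcsin x + pi/2 = arccos (- x)"
  by (simp add: arcsin_arccos_eq arccos_minus)

lemma arccos_minus_pos: "\<lbrakk>- 1 < x; x \<le> 1\<rbrakk> \<Longrightarrow> 0 < arccos (- x)"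
  using arccos_lbound[of "- x"] arccos_eq_0_iff[of "- x"] by (auto simp: less_le)

section \<open>The function \<open>f0\<close>\<close>

definition f0_lift :: "complex \<Rightarrow> complex" where
  "f0_lift t = t\<^sup>2 * numer_red t"

lemma f0_lift_eq: "t \<noteq> 0 \<Longrightarrow> f0_lift t = numer t / t\<^sup>2"
  by (simp add: f0_lift_def numer_eq field_simps power4_eq_xxxx power2_eq_square)

interpretation f0: even_strip_function f0_lift UNIV pi
proof
  show "f0_lift holomorphic_on UNIV"
    unfolding f0_lift_def[abs_def] by (intro holomorphic_intros numer_red_holomorphic)
qed (simp_all add: f0_lift_def numer_red_even numer_red_cnj)

lemma f0_lift_of_real:
  assumes "- 1 < x" "x < 1"
  shows "f0_lift (of_real (arccos (- x))) = of_real (f0 x)"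
proof -
  define s where "s = arccos (- x)"
  have s: "0 < s" "cos s = - x" "sin s = sqrt (1 - x\<^sup>2)" "arcsin x + pi/2 = s"
    using assms arccos_minus_pos by (simp_all add: s_def sin_arccos arcsin_plus_half_pi)
  have "f0_lift (of_real s) = of_real ((s\<^sup>2 * x + s * sqrt (1 - x\<^sup>2) - pi/2 * (1 + x)\<^sup>2) / s\<^sup>2)"
    using s(1) by (simp add: f0_lift_eq numer_of_real s(2,3))
  also have "(s\<^sup>2 * x + s * sqrt (1 - x\<^sup>2) - pi/2 * (1 + x)\<^sup>2) / s\<^sup>2 = f0 x"
    using s(1) unfolding f0_def s(4)
    by (simp add: diff_divide_distrib add_divide_distrib power2_eq_square)
  finally show ?thesis unfolding s_def .
qed

lemma numer_right_line:
  "numer (Complex pi s) = Complex ((pi\<^sup>2 - s\<^sup>2) * cosh s + s * sinh s - pi/2 * (1 + cosh s)\<^sup>2)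
      (2 * pi * s * cosh s - pi * sinh s)"
  unfolding numer_def cos_Complex sin_Complex
  by (simp add: complex_eq_iff power2_eq_square algebra_simps)

lemma sinh_times_le_one_plus_cosh_squared:
  fixes s :: real
  assumes "0 \<le> s"
  shows "sinh s * (pi\<^sup>2 + s\<^sup>2) \<le> pi * s * (1 + cosh s)\<^sup>2"
proof -
  have "pi\<^sup>2 \<le> 4 * pi" "1 * s\<^sup>2 \<le> pi * s\<^sup>2"
    using pi_less_4 pi_gt3 by (simp add: power2_eq_square, intro mult_right_mono) auto
  moreover have "pi * (1 + (1 + s\<^sup>2/2)) \<le> pi * (1 + cosh s)"
    using cosh_ge_quadratic[OF assms] by simp
  ultimately have "(pi\<^sup>2 + s\<^sup>2) / 2 \<le> pi * (1 + cosh s)" by (simp add: algebra_simps)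
  then have "s * (1 + cosh s) * ((pi\<^sup>2 + s\<^sup>2) / 2) \<le> s * (1 + cosh s) * (pi * (1 + cosh s))"
    using assms by (intro mult_left_mono mult_nonneg_nonneg) (auto intro: add_nonneg_nonneg)
  moreover have "sinh s * (pi\<^sup>2 + s\<^sup>2) \<le> s / 2 * (1 + cosh s) * (pi\<^sup>2 + s\<^sup>2)"
    using sinh_le_half_one_plus_cosh[OF assms] by (intro mult_right_mono) auto
  ultimately show ?thesis by (simp add: power2_eq_square algebra_simps)
qed

lemma Im_f0_lift_right_line:
  "Im (f0_lift (Complex pi s)) = pi * (pi * s * (1 + cosh s)\<^sup>2 - sinh s * (pi\<^sup>2 + s\<^sup>2)) / (pi\<^sup>2 + s\<^sup>2)\<^sup>2"
proof -
  have "Complex pi s \<noteq> 0" by (simp add: complex_eq_iff)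
  moreover have "(Complex pi s)\<^sup>2 = Complex (pi\<^sup>2 - s\<^sup>2) (2 * pi * s)"
    by (simp add: complex_eq_iff power2_eq_square)
  ultimately have "Im (f0_lift (Complex pi s)) =
      ((2 * pi * s * cosh s - pi * sinh s) * (pi\<^sup>2 - s\<^sup>2) -
        ((pi\<^sup>2 - s\<^sup>2) * cosh s + s * sinh s - pi/2 * (1 + cosh s)\<^sup>2) * (2 * pi * s)) /
      ((pi\<^sup>2 - s\<^sup>2)\<^sup>2 + (2 * pi * s)\<^sup>2)"
    by (simp add: f0_lift_eq numer_right_line Im_divide)
  also have "(pi\<^sup>2 - s\<^sup>2)\<^sup>2 + (2 * pi * s)\<^sup>2 = (pi\<^sup>2 + s\<^sup>2)\<^sup>2"
    by (simp add: power2_eq_square algebra_simps)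
  also have "(2 * pi * s * cosh s - pi * sinh s) * (pi\<^sup>2 - s\<^sup>2) -
        ((pi\<^sup>2 - s\<^sup>2) * cosh s + s * sinh s - pi/2 * (1 + cosh s)\<^sup>2) * (2 * pi * s) =
      pi * (pi * s * (1 + cosh s)\<^sup>2 - sinh s * (pi\<^sup>2 + s\<^sup>2))"
    by (simp add: power2_eq_square algebra_simps)
  finally show ?thesis .
qed

lemma f0_right_side_integral_nonneg:
  assumes "0 < R"
  shows "0 \<le> Im (segment_integral (Complex pi 0) (Complex pi R) (cos_kernel f0_lift n))"
proof (rule Im_contour_integral_vertical_ge[OF assms])
  show "((\<lambda>_. 0) has_integral 0) {0..R}" by simp
  show "continuous_on (closed_segment (Complex pi 0) (Complex pi R)) (cos_kernel f0_lift n)"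
  proof (intro holomorphic_on_imp_continuous_on cos_kernel_holomorphic
      holomorphic_on_subset[OF f0.holomorphic])
    show "cos t \<noteq> 0" if "t \<in> closed_segment (Complex pi 0) (Complex pi R)" for t
      using that by (intro cos_nonzero_strip) (auto simp: closed_segment_same_Re)
  qed simp
  fix s assume "s \<in> {0..R}"
  then show "0 \<le> Re (cos_kernel f0_lift n (Complex pi s))"
    unfolding Re_cos_kernel_right_line Im_f0_lift_right_line
    using sinh_times_le_one_plus_cosh_squared[of s] by auto
qed

lemma f0_lift_horizontal_bound:
  "horizontal_bound f0_lift pi
     (\<lambda>R. ((R + pi)\<^sup>2 * cosh R + (R + pi) * cosh R + pi/2 * (1 + cosh R)\<^sup>2) / R\<^sup>2)"
  unfolding horizontal_bound_def using eventually_ge_at_top[of 1]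
proof (eventually_elim, intro allI impI)
  fix R t assume R: "1 \<le> R" and t: "0 \<le> Re t" "Re t \<le> pi" "Im t = R"
  have norm_t: "R \<le> cmod t" "cmod t \<le> R + pi" "t \<noteq> 0"
    using abs_Im_le_cmod[of t] cmod_le[of t] t R by auto
  have numer_t: "cmod (numer t) \<le> (R + pi)\<^sup>2 * cosh R + (R + pi) * cosh R + pi/2 * (1 + cosh R)\<^sup>2"
    using norm_t cmod_sin_le[of t] cmod_cos_le[of t] t by (intro cmod_numer_le) auto
  then show "cmod (f0_lift t) \<le> ((R + pi)\<^sup>2 * cosh R + (R + pi) * cosh R + pi/2 * (1 + cosh R)\<^sup>2) / R\<^sup>2"
    unfolding f0_lift_eq[OF norm_t(3)] norm_divide norm_power
    using order_trans[OF norm_ge_zero numer_t] norm_t R by (intro frac_le power_mono) auto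
qed

lemma f0_Taylor_coeff_nonneg:
  assumes "2 \<le> n"
  shows "0 \<le> Re ((deriv ^^ n) (cos_descent f0_lift) 0)"
proof (rule f0.Taylor_coeff_nonneg[OF horizontal_bound_cos_kernel[OF f0_lift_horizontal_bound]])
  show "3 \<le> Suc n" using assms by simp
  show "((\<lambda>R. ((R + pi)\<^sup>2 * cosh R + (R + pi) * cosh R + pi/2 * (1 + cosh R)\<^sup>2) / R\<^sup>2 *
      cosh R / sinh R ^ 3) \<longlongrightarrow> 0) at_top"
    unfolding sinh_field_def cosh_field_def by real_asymp
  show "\<forall>\<^sub>F R in at_top. - 0 \<le>
      Im (segment_integral (Complex pi 0) (Complex pi R) (cos_kernel f0_lift n))"
    using eventually_gt_at_top[of 0] by eventually_elim (simp add: f0_right_side_integral_nonneg)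
qed simp

lemma f0_deriv_at_0: "(f0 has_real_derivative (1 - 2/pi)\<^sup>2) (at 0)"
proof -
  have "(f0 has_real_derivative
     1 + (0 * (pi/2) - 1 * 1) / (pi/2 * (pi/2)) -
      ((pi/2 * 2) * (pi/2)\<^sup>2 - pi/2 * (2 * (pi/2))) / ((pi/2)\<^sup>2 * (pi/2)\<^sup>2)) (at 0)"
    unfolding f0_def[abs_def]
    by (auto intro!: derivative_eq_intros simp: power2_eq_square)
  also have "1 + (0 * (pi/2) - 1 * 1) / (pi/2 * (pi/2)) -
      ((pi/2 * 2) * (pi/2)\<^sup>2 - pi/2 * (2 * (pi/2))) / ((pi/2)\<^sup>2 * (pi/2)\<^sup>2) = (1 - 2/pi)\<^sup>2"
    by (simp add: field_simps power2_eq_square)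
  finally show ?thesis .
qed

lemma cos_descent_f0_lift: "\<lbrakk>- 1 < x; x < 1\<rbrakk> \<Longrightarrow> cos_descent f0_lift (of_real x) = of_real (f0 x)"
  by (simp add: cos_descent_of_real f0_lift_of_real)

lemma f0_first_Taylor_coeff: "Re (deriv (cos_descent f0_lift) 0) = (1 - 2/pi)\<^sup>2"
proof -
  have "(cos_descent f0_lift has_field_derivative deriv (cos_descent f0_lift) 0) (at (of_real 0))"
    using holomorphic_derivI[OF f0.cos_descent_holomorphic open_ball, of 0] by simp
  then have "((\<lambda>x. Re (cos_descent f0_lift (of_real x))) has_real_derivative
      Re (deriv (cos_descent f0_lift) 0)) (at 0)"
    by (rule has_real_derivative_Re_of_real)
  then have "(f0 has_real_derivative Re (deriv (cos_descent f0_lift) 0)) (at 0)"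
    by (rule has_field_derivative_transform_within_open[of _ _ _ "{-1<..<1}"])
       (simp_all add: cos_descent_f0_lift)
  then show ?thesis using f0_deriv_at_0 by (rule DERIV_unique)
qed

lemma f0_continuous: "continuous_on {0..1} f0"
proof -
  have "arcsin x + pi/2 \<noteq> 0" if "x \<in> {0..1}" for x
    using that arccos_minus_pos[of x] by (simp add: arcsin_plus_half_pi)
  then show ?thesis unfolding f0_def[abs_def] by (intro continuous_intros) auto
qed

theorem absolutely_monotone_f0: "absolutely_monotone_01 f0"
proof (rule f0.absolutely_monotone_01[OF _ _ f0_continuous])
  fix n :: nat
  consider "n = 0" | "n = 1" | "2 \<le> n" by linarith
  then show "0 \<le> Re ((deriv ^^ n) (cos_descent f0_lift) 0)"
  proof cases
    case 1
    have "f0 0 = 0" by (simp add: f0_def power2_eq_square)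
    then show ?thesis using cos_descent_f0_lift[of 0] 1 by simp
  next
    case 2
    then show ?thesis by (simp add: f0_first_Taylor_coeff)
  next
    case 3
    then show ?thesis by (rule f0_Taylor_coeff_nonneg)
  qed
qed (simp add: f0_lift_of_real)

section \<open>Numerical values of the hyperbolic functions\<close>

lemma exp_Taylor_bound:
  fixes x :: real
  shows "\<bar>exp x - (\<Sum>m<n. x ^ m / fact m)\<bar> \<le> exp \<bar>x\<bar> * \<bar>x\<bar> ^ n / fact n"
proof -
  obtain t where t: "\<bar>t\<bar> \<le> \<bar>x\<bar>" "exp x = (\<Sum>m<n. x ^ m / fact m) + exp t / fact n * x ^ n"
    using Maclaurin_exp_le[of x n] by blast
  have "exp t * \<bar>x\<bar> ^ n / fact n \<le> exp \<bar>x\<bar> * \<bar>x\<bar> ^ n / fact n"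
    using t(1) by (intro divide_right_mono mult_right_mono) auto
  then show ?thesis unfolding t(2) by (simp add: abs_mult power_abs)
qed

lemma cosh_sinh_Taylor_bounds:
  fixes x :: real
  assumes "0 \<le> x" "x \<le> 2"
  defines "C \<equiv> 1 + x^2/2 + x^4/24 + x^6/720 + x^8/40320 + x^10/3628800"
    and "S \<equiv> x + x^3/6 + x^5/120 + x^7/5040 + x^9/362880 + x^11/39916800"
    and "e \<equiv> 9 * x^12 / 479001600"
  shows "C - e \<le> cosh x" "cosh x \<le> C + e" "S - e \<le> sinh x" "sinh x \<le> S + e"
proof -
  have "exp x \<le> exp (1 + 1)" using assms(2) by simp
  also have "\<dots> \<le> 3 * 3" unfolding exp_add using exp_le by (intro mult_mono) auto
  finally have "exp \<bar>x\<bar> * \<bar>x\<bar> ^ 12 / fact 12 \<le> 9 * x ^ 12 / fact 12"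
    using assms(1) by (simp add: divide_right_mono mult_right_mono)
  then have "\<bar>exp x - (\<Sum>m<12. x ^ m / fact m)\<bar> \<le> 9 * x ^ 12 / fact 12"
    "\<bar>exp (- x) - (\<Sum>m<12. (- x) ^ m / fact m)\<bar> \<le> 9 * x ^ 12 / fact 12"
    using exp_Taylor_bound[of x 12] exp_Taylor_bound[of "- x" 12] by simp_all
  moreover have "(\<Sum>m<12. x ^ m / fact m) = C + S" "(\<Sum>m<12. (- x) ^ m / fact m) = C - S"
    by (simp_all add: C_def S_def lessThan_nat_numeral lessThan_Suc fact_numeral)
  ultimately have "\<bar>exp x - (C + S)\<bar> \<le> e" "\<bar>exp (- x) - (C - S)\<bar> \<le> e"
    by (simp_all add: e_def fact_numeral)
  then show "C - e \<le> cosh x" "cosh x \<le> C + e" "S - e \<le> sinh x" "sinh x \<le> S + e"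
    unfolding cosh_field_def sinh_field_def by argo+
qed

lemma cosh_sinh_1_05:
  "1.603794 \<le> cosh (1.05::real)" "cosh (1.05::real) \<le> 1.603795"
  "1.253856 \<le> sinh (1.05::real)" "sinh (1.05::real) \<le> 1.253857"
  and cosh_sinh_1_083:
  "1.6460520 \<le> cosh (1.083::real)" "cosh (1.083::real) \<le> 1.6460531"
  "1.3074737 \<le> sinh (1.083::real)" "sinh (1.083::real) \<le> 1.3074748"
  and cosh_sinh_1_088:
  "1.6526100 \<le> cosh (1.088::real)" "cosh (1.088::real) \<le> 1.6526111"
  "1.3157204 \<le> sinh (1.088::real)" "sinh (1.088::real) \<le> 1.3157215"
  and cosh_sinh_1_093:
  "1.6592093 \<le> cosh (1.093::real)" "cosh (1.093::real) \<le> 1.6592104"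
  "1.3239999 \<le> sinh (1.093::real)" "sinh (1.093::real) \<le> 1.3240010"
  by (rule order_trans[OF _ cosh_sinh_Taylor_bounds(1)] order_trans[OF cosh_sinh_Taylor_bounds(2)]
       order_trans[OF _ cosh_sinh_Taylor_bounds(3)] order_trans[OF cosh_sinh_Taylor_bounds(4)];
      simp add: power_divide)+

lemma pi_bounds: "3.1415926 \<le> pi" "pi \<le> 3.1415927"
  using pi_approx by auto

section \<open>The density of \<open>g0\<close> on the line \<open>Re t = pi\<close>\<close>

abbreviation crossover :: real where "crossover \<equiv> 1.653"
abbreviation box_left :: real where "box_left \<equiv> pi - 0.005"
abbreviation box_bottom :: real where "box_bottom \<equiv> 1.083"
abbreviation box_top :: real where "box_top \<equiv> 1.093"

definition denom_re :: "real \<Rightarrow> real" where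
  "denom_re s = pi\<^sup>2 - s\<^sup>2 + s * sinh s * cosh s - pi/2 * (1 + cosh s)\<^sup>2"

definition denom_im :: "real \<Rightarrow> real" where
  "denom_im s = pi * (2 * s - sinh s * cosh s)"

lemma denom_right_line: "denom (Complex pi s) = Complex (denom_re s) (denom_im s)"
  unfolding denom_def cos_Complex sin_Complex denom_re_def denom_im_def
  by (simp add: complex_eq_iff power2_eq_square algebra_simps)

definition self_coth_half :: "real \<Rightarrow> real" where
  "self_coth_half s = s * (1 + cosh s) / sinh s"

definition density_factor :: "real \<Rightarrow> real" where
  "density_factor s = pi\<^sup>2 + s\<^sup>2 - pi * self_coth_half s - pi/2 * (1 + cosh s)"

definition g0_density :: "real \<Rightarrow> real" where
  "g0_density s = (crossover - cosh s) * Im (numer (Complex pi s) / denom (Complex pi s)) * sinh s"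

lemma g0_density_eq:
  assumes "0 < s"
  shows "g0_density s =
    pi * sinh s ^ 4 * ((crossover - cosh s) * density_factor s) / ((denom_re s)\<^sup>2 + (denom_im s)\<^sup>2)"
proof -
  define c where "c = cosh s"
  define h where "h = sinh s"
  have h: "h \<noteq> 0" "c * c - 1 = h * h"
    using assms cosh_square_eq[of s] by (simp_all add: c_def h_def power2_eq_square)
  have "Im (numer (Complex pi s) / denom (Complex pi s)) =
     ((2 * pi * s * c - pi * h) * denom_re s - ((pi\<^sup>2 - s\<^sup>2) * c + s * h - pi/2 * (1 + c)\<^sup>2) * denom_im s) /
     ((denom_re s)\<^sup>2 + (denom_im s)\<^sup>2)"
    unfolding denom_right_line numer_right_line by (simp add: Im_divide c_def h_def)
  also have "(2 * pi * s * c - pi * h) * denom_re s -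
      ((pi\<^sup>2 - s\<^sup>2) * c + s * h - pi/2 * (1 + c)\<^sup>2) * denom_im s =
      pi * (c * c - 1) * (h * (pi\<^sup>2 + s\<^sup>2) - pi/2 * (1 + c) * (2 * s + h))"
    unfolding denom_re_def denom_im_def c_def[symmetric] h_def[symmetric] by algebra
  also have "c * c - 1 = h * h" by (rule h(2))
  also have "h * (pi\<^sup>2 + s\<^sup>2) - pi/2 * (1 + c) * (2 * s + h) = h * density_factor s"
    unfolding density_factor_def self_coth_half_def c_def[symmetric] h_def[symmetric]
    using h(1) by (simp add: field_simps)
  finally show ?thesis by (simp add: g0_density_def c_def h_def power4_eq_xxxx)
qed

lemma self_coth_half_deriv:
  assumes "0 < s"
  shows "(self_coth_half has_real_derivative (1 + cosh s) * (sinh s - s) / (sinh s)\<^sup>2) (at s)"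
proof -
  have "sinh s \<noteq> 0" using assms by simp
  then have "(self_coth_half has_real_derivative
      ((1 * (1 + cosh s) + sinh s * s) * sinh s - s * (1 + cosh s) * cosh s) / (sinh s * sinh s)) (at s)"
    unfolding self_coth_half_def[abs_def] by (auto intro!: derivative_eq_intros)
  also have "(1 * (1 + cosh s) + sinh s * s) * sinh s - s * (1 + cosh s) * cosh s =
      (1 + cosh s) * (sinh s - s)"
    using cosh_square_eq[of s] by (simp add: algebra_simps power2_eq_square)
  finally show ?thesis by (simp add: power2_eq_square)
qed

lemma self_coth_half_deriv_ge:
  fixes s :: real
  assumes "0 < s"
  shows "2 * s / (6 + s\<^sup>2) \<le> (1 + cosh s) * (sinh s - s) / (sinh s)\<^sup>2"
proof -
  have pos: "0 < sinh s" "0 < 6 + s\<^sup>2"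
    using assms sinh_ge_self[of s] by (linarith, simp add: add_pos_nonneg)
  have "s * (6 + s\<^sup>2) \<le> 6 * sinh s"
    using sinh_ge_cubic[of s] assms by (simp add: algebra_simps power2_eq_square power3_eq_cube)
  then have "s / sinh s \<le> 6 / (6 + s\<^sup>2)" using pos by (simp add: divide_simps mult.commute)
  then have "2 / s * (1 - 6 / (6 + s\<^sup>2)) \<le> 2 / s * (1 - s / sinh s)"
    using assms by (intro mult_left_mono) auto
  moreover have "2 / s * (1 - 6 / (6 + s\<^sup>2)) = 2 * s / (6 + s\<^sup>2)"
    using pos(2) assms by (simp add: divide_simps) (simp add: power2_eq_square algebra_simps)
  moreover have "2 / s * (1 - s / sinh s) = 2 * sinh s / s * (sinh s - s) / (sinh s)\<^sup>2"
    using pos(1) assms by (simp add: field_simps power2_eq_square)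
  moreover have "2 * sinh s / s \<le> 1 + cosh s"
    using sinh_le_half_one_plus_cosh[of s] assms by (simp add: field_simps)
  then have "2 * sinh s / s * (sinh s - s) / (sinh s)\<^sup>2 \<le> (1 + cosh s) * (sinh s - s) / (sinh s)\<^sup>2"
    using sinh_ge_self[of s] assms by (intro divide_right_mono mult_right_mono) auto
  ultimately show ?thesis by simp
qed

lemma density_factor_plus_cosh_antimono:
  assumes "0 < a" "a \<le> b" "c \<le> pi/2"
    and cond: "\<And>s. s \<in> {a..b} \<Longrightarrow> (2 - (pi/2 - c) * (1 + s\<^sup>2/6)) * (6 + s\<^sup>2) \<le> 2 * pi"
  shows "density_factor b + c * cosh b \<le> density_factor a + c * cosh a"
proof (rule deriv_nonpos_imp_antimono[OF _ _ assms(2)])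
  let ?K' = "\<lambda>s::real. (1 + cosh s) * (sinh s - s) / (sinh s)\<^sup>2"
  fix s assume s: "s \<in> {a..b}"
  then have pos: "0 < s" "0 < 6 + s\<^sup>2" using assms(1) by (auto intro: add_pos_nonneg)
  show "((\<lambda>s. density_factor s + c * cosh s) has_real_derivative
      2 * s - pi * ?K' s - (pi/2 - c) * sinh s) (at s)"
    unfolding density_factor_def[abs_def] using self_coth_half_deriv[OF pos(1)]
    by (auto intro!: derivative_eq_intros simp: algebra_simps)
  have "pi * (2 * s / (6 + s\<^sup>2)) \<le> pi * ?K' s"
    using self_coth_half_deriv_ge[OF pos(1)] by (intro mult_left_mono) auto
  moreover have "(pi/2 - c) * (s * (1 + s\<^sup>2/6)) \<le> (pi/2 - c) * sinh s"
    using sinh_ge_cubic[of s] pos(1) assms(3)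
    by (intro mult_left_mono) (auto simp: algebra_simps power2_eq_square power3_eq_cube)
  moreover have "2 - (pi/2 - c) * (1 + s\<^sup>2/6) \<le> 2 * pi / (6 + s\<^sup>2)"
    using cond[OF s] pos(2) by (simp add: pos_le_divide_eq)
  then have "s * (2 - (pi/2 - c) * (1 + s\<^sup>2/6)) \<le> s * (2 * pi / (6 + s\<^sup>2))"
    using pos(1) by (intro mult_left_mono) auto
  then have "2 * s - (pi/2 - c) * (s * (1 + s\<^sup>2/6)) \<le> pi * (2 * s / (6 + s\<^sup>2))"
    by (simp add: algebra_simps)
  ultimately show "2 * s - pi * ?K' s - (pi/2 - c) * sinh s \<le> 0" by linarith
qed

lemma density_factor_antimono:
  assumes "0 < a" "a \<le> b"
  shows "density_factor b \<le> density_factor a"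
proof -
  have "(2 - (pi/2 - 0) * (1 + s\<^sup>2/6)) * (6 + s\<^sup>2) \<le> 2 * pi" for s
  proof -
    have "(2 - (pi/2 - 0) * (1 + s\<^sup>2/6)) * (6 + s\<^sup>2) = 12 - 3 * pi - (pi - 2) * s\<^sup>2 - pi * (s\<^sup>2)\<^sup>2 / 12"
      by (simp add: algebra_simps power2_eq_square)
    moreover have "0 \<le> (pi - 2) * s\<^sup>2" "0 \<le> pi * (s\<^sup>2)\<^sup>2 / 12" using pi_gt3 by auto
    ultimately show ?thesis using pi_gt3 by linarith
  qed
  from density_factor_plus_cosh_antimono[OF assms _ this] show ?thesis by simp
qed

lemma density_factor_bounds:
  assumes "0 < s" "0 \<le> C" "0 < S"
  shows "\<lbrakk>cosh s \<le> C; S \<le> sinh s\<rbrakk> \<Longrightarrow>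
      3.1415926\<^sup>2 + s\<^sup>2 - 3.1415927 * (s * (1 + C) / S) - 3.1415927/2 * (1 + C) \<le> density_factor s"
    and "\<lbrakk>C \<le> cosh s; sinh s \<le> S\<rbrakk> \<Longrightarrow>
      density_factor s \<le> 3.1415927\<^sup>2 + s\<^sup>2 - 3.1415926 * (s * (1 + C) / S) - 3.1415926/2 * (1 + C)"
  unfolding density_factor_def self_coth_half_def using assms pi_bounds
  by (intro diff_mono add_right_mono power_mono mult_mono frac_le divide_right_mono; simp)+

lemma density_factor_pos: "\<lbrakk>0 < s; s \<le> box_bottom\<rbrakk> \<Longrightarrow> 0 < density_factor s"
  using density_factor_antimono[of s box_bottom]
    density_factor_bounds(1)[of box_bottom "1.6460531" "1.3074737"]
    cosh_sinh_1_083 by (simp add: power_divide)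

lemma density_factor_neg: "box_top \<le> s \<Longrightarrow> density_factor s < 0"
  using density_factor_antimono[of box_top s]
    density_factor_bounds(2)[of box_top "1.6592093" "1.3240010"]
    cosh_sinh_1_093 by (simp add: power_divide)

lemma g0_density_nonneg:
  assumes "0 \<le> s" "s \<le> box_bottom \<or> box_top \<le> s"
  shows "0 \<le> g0_density s"
proof (cases "s = 0")
  case True then show ?thesis by (simp add: g0_density_def)
next
  case False
  then have s: "0 < s" using assms by simp
  have nonneg: "0 \<le> (crossover - cosh s) * density_factor s"
    using assms(2)
  proof
    assume below: "s \<le> box_bottom"
    then have "cosh s \<le> cosh box_bottom" using assms by (simp add: cosh_real_nonneg_le_iff)
    then show ?thesis
      using cosh_sinh_1_083 density_factor_pos[OF s below] by (intro mult_nonneg_nonneg) auto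
  next
    assume above: "box_top \<le> s"
    then have "cosh box_top \<le> cosh s" using assms by (simp add: cosh_real_nonneg_le_iff)
    then show ?thesis
      using cosh_sinh_1_093 density_factor_neg[OF above] by (intro mult_nonpos_nonpos) auto
  qed
  show ?thesis
    unfolding g0_density_eq[OF s] by (intro divide_nonneg_nonneg mult_nonneg_nonneg[OF _ nonneg]) auto
qed

lemma sinh_cosh_over_self_mono:
  fixes a b :: real
  assumes "0 < a" "a \<le> b"
  shows "sinh a * cosh a / a \<le> sinh b * cosh b / b"
proof (rule deriv_nonneg_imp_mono[OF _ _ assms(2)])
  fix s assume "s \<in> {a..b}"
  then have s: "0 < s" using assms by simp
  then show "((\<lambda>s. sinh s * cosh s / s) has_real_derivative
      ((s * cosh s - sinh s) * cosh s + (sinh s)\<^sup>2 * s) / s\<^sup>2) (at s)"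
    by (auto intro!: derivative_eq_intros simp: algebra_simps power2_eq_square)
  show "0 \<le> ((s * cosh s - sinh s) * cosh s + (sinh s)\<^sup>2 * s) / s\<^sup>2"
    using sinh_le_self_cosh[of s] s by simp
qed

lemma denom_im_pos:
  assumes "0 < s" "s \<le> box_bottom"
  shows "0 < denom_im s"
proof -
  have "sinh box_bottom * cosh box_bottom \<le> 1.3074748 * 1.6460531"
    using cosh_sinh_1_083 by (intro mult_mono) auto
  then have "sinh box_bottom * cosh box_bottom / box_bottom \<le> 1.3074748 * 1.6460531 / box_bottom"
    by (rule divide_right_mono) simp
  also have "\<dots> < (2::real)" by simp
  finally have "sinh s * cosh s / s < 2"
    using sinh_cosh_over_self_mono[OF assms] by linarith
  then show ?thesis using assms by (simp add: denom_im_def divide_simps)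
qed

lemma denom_im_neg:
  assumes "box_top \<le> s"
  shows "denom_im s < 0"
proof -
  have "1.3239999 * 1.6592093 \<le> sinh box_top * cosh box_top"
    using cosh_sinh_1_093 by (intro mult_mono) auto
  then have "1.3239999 * 1.6592093 / box_top \<le> sinh box_top * cosh box_top / box_top"
    by (rule divide_right_mono) simp
  also have "\<dots> \<le> sinh s * cosh s / s"
    by (rule sinh_cosh_over_self_mono[OF _ assms]) simp
  finally have "2 < sinh s * cosh s / s"
    by (rule less_le_trans[rotated]) simp
  then show ?thesis using assms by (simp add: denom_im_def mult_less_0_iff divide_simps)
qed

lemma cosh_sinh_middle:
  fixes s :: real
  assumes "0.7 \<le> s" "s \<le> 1.05"
  shows "0.75 \<le> sinh s" "sinh s \<le> 1.26" "1.24 \<le> cosh s" "cosh s \<le> 1.61"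
proof -
  have "0.7 ^ 3 \<le> s ^ 3" "0.7 ^ 2 \<le> s ^ 2" using assms by (auto intro!: power_mono)
  then show "0.75 \<le> sinh s" "1.24 \<le> cosh s"
    using sinh_ge_cubic[of s] cosh_ge_quadratic[of s] assms
    by (simp_all add: power3_eq_cube power2_eq_square)
  have "sinh s \<le> sinh 1.05" using assms by (simp only: sinh_real_le_iff)
  then show "sinh s \<le> 1.26" by (rule order_trans) (use cosh_sinh_1_05 in simp)
  have "cosh s \<le> cosh 1.05" using assms by (simp add: cosh_real_nonneg_le_iff)
  then show "cosh s \<le> 1.61" by (rule order_trans) (use cosh_sinh_1_05 in simp)
qed

lemma density_factor_ge:
  assumes "0.7 \<le> s" "s \<le> 1.05"
  shows "0.6 * (crossover - cosh s) \<le> density_factor s"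
proof -
  have "(2 - (pi/2 - 0.6) * (1 + u\<^sup>2/6)) * (6 + u\<^sup>2) \<le> 2 * pi" if u: "u \<in> {s..1.05}" for u
  proof -
    define x where "x = u\<^sup>2"
    have "0.7\<^sup>2 \<le> u\<^sup>2" "u\<^sup>2 \<le> 1.05\<^sup>2" using assms(1) u by (auto intro!: power_mono)
    then have x: "49/100 \<le> x" "x \<le> 441/400" by (simp_all add: x_def power_divide)
    have "(2 - (pi/2 - 0.6) * (1 + x/6)) * (6 + x) \<le> (2 - (6283/4000 - 3/5) * (1 + x/6)) * (6 + x)"
      using pi_bounds x by (intro mult_right_mono diff_left_mono) auto
    also have "\<dots> \<le> 6283/1000"
      using x zero_le_square[of x] by argo
    finally show ?thesis using pi_bounds by (simp add: x_def)
  qed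
  then have "density_factor 1.05 + 0.6 * cosh 1.05 \<le> density_factor s + 0.6 * cosh s"
    using assms pi_gt3 by (intro density_factor_plus_cosh_antimono) auto
  moreover have "0.6 * (crossover - cosh 1.05) \<le> density_factor 1.05"
    using density_factor_bounds(1)[of "1.05" "1.603795" "1.253856"] cosh_sinh_1_05
    by (simp add: power_divide)
  ultimately show ?thesis by simp
qed

lemma denom_im_le:
  assumes s: "0.7 \<le> s" "s \<le> 1.05"
  shows "denom_im s \<le> 5.8 * (crossover - cosh s)"
proof -
  let ?f = "\<lambda>s. 5.8 * (crossover - cosh s) - denom_im s"
  have "?f 1.05 \<le> ?f s"
  proof (rule deriv_nonpos_imp_antimono[OF _ _ s(2)])
    fix x assume "x \<in> {s..1.05}"
    then have x: "0.7 \<le> x" "0.75 \<le> sinh x" "sinh x \<le> 1.26" using cosh_sinh_middle[of x] s by auto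
    have "(?f has_real_derivative
        - 5.8 * sinh x - pi * (2 - (cosh x * cosh x + sinh x * sinh x))) (at x)"
      unfolding denom_im_def[abs_def] by (auto intro!: derivative_eq_intros simp: algebra_simps)
    also have "- 5.8 * sinh x - pi * (2 - (cosh x * cosh x + sinh x * sinh x)) =
        sinh x * (2 * (pi * sinh x) - 5.8) - pi"
      using cosh_square_eq[of x] by (simp add: power2_eq_square algebra_simps)
    finally show "(?f has_real_derivative sinh x * (2 * (pi * sinh x) - 5.8) - pi) (at x)" .
    have "pi * sinh x \<le> 3.1416 * 1.26" using x pi_bounds by (intro mult_mono) auto
    then have "sinh x * (2 * (pi * sinh x) - 5.8) \<le> sinh x * 2.2" using x by (intro mult_left_mono) auto
    also have "\<dots> \<le> 3" using x by simp
    finally show "sinh x * (2 * (pi * sinh x) - 5.8) - pi \<le> 0" using pi_gt3 by linarith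
  qed
  moreover have "1.253856 * 1.603794 \<le> sinh (1.05::real) * cosh 1.05"
    using cosh_sinh_1_05 by (intro mult_mono) auto
  then have "denom_im 1.05 \<le> 3.1416 * (2 * 1.05 - 1.253856 * 1.603794)"
    using pi_bounds denom_im_pos[of "1.05"] unfolding denom_im_def
    by (intro mult_mono) (auto simp: zero_less_mult_iff)
  then have "0 \<le> ?f 1.05" using cosh_sinh_1_05 by simp
  ultimately show ?thesis by linarith
qed

lemma denom_re_deriv:
  "(denom_re has_real_derivative 2 * x * (sinh x)\<^sup>2 - x + sinh x * (cosh x - pi - pi * cosh x)) (at x)"
proof -
  have "(denom_re has_real_derivative
      - (2 * x) + ((1 * sinh x + cosh x * x) * cosh x + sinh x * (x * sinh x))
      - pi/2 * (2 * (1 + cosh x) * sinh x)) (at x)"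
    unfolding denom_re_def[abs_def]
    by (auto intro!: derivative_eq_intros simp: algebra_simps power2_eq_square)
  also have "- (2 * x) + ((1 * sinh x + cosh x * x) * cosh x + sinh x * (x * sinh x))
      - pi/2 * (2 * (1 + cosh x) * sinh x) =
      2 * x * (sinh x)\<^sup>2 - x + sinh x * (cosh x - pi - pi * cosh x)"
    using cosh_square_eq[of x] by (simp add: algebra_simps power2_eq_square)
  finally show ?thesis .
qed

lemma denom_re_deriv_le:
  fixes x :: real
  assumes "0.7 \<le> x" "x \<le> 1.05"
  shows "2 * x * (sinh x)\<^sup>2 - x + sinh x * (cosh x - pi - pi * cosh x) \<le> 6 * sinh x"
proof -
  note hyp = cosh_sinh_middle[OF assms]
  have "x * sinh x \<le> 1.05 * 1.26" using hyp assms by (intro mult_mono) auto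
  then have "2 * (x * sinh x) * sinh x \<le> 6 * sinh x" using hyp assms(1) by (intro mult_right_mono) auto
  moreover have "1 * cosh x \<le> pi * cosh x" using hyp pi_gt3 by (intro mult_right_mono) auto
  then have "sinh x * (cosh x - pi - pi * cosh x) \<le> 0"
    using hyp assms(1) pi_gt_zero by (intro mult_nonneg_nonpos) (simp, linarith)
  moreover have "2 * x * (sinh x)\<^sup>2 = 2 * (x * sinh x) * sinh x" by (simp add: power2_eq_square)
  ultimately show ?thesis using assms(1) by linarith
qed

lemma denom_re_deriv_ge:
  fixes x :: real
  assumes "0.7 \<le> x" "x \<le> 1.05"
  shows "- (6 * sinh x) \<le> 2 * x * (sinh x)\<^sup>2 - x + sinh x * (cosh x - pi - pi * cosh x)"
proof -
  note hyp = cosh_sinh_middle[OF assms]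
  have "sinh x \<le> x / 2 * (1 + cosh x)" using assms by (intro sinh_le_half_one_plus_cosh) auto
  also have "\<dots> \<le> x / 2 * 2.61" using hyp assms by (intro mult_left_mono) auto
  finally have "sinh x / 1.305 \<le> x" by simp
  moreover have "0.75 * 0.75 \<le> sinh x * sinh x" using hyp assms(1) by (intro mult_mono) auto
  then have "0 \<le> 2 * (sinh x)\<^sup>2 - 1" by (simp add: power2_eq_square)
  ultimately have "sinh x / 1.305 * (2 * (sinh x)\<^sup>2 - 1) \<le> x * (2 * (sinh x)\<^sup>2 - 1)"
    by (rule mult_right_mono)
  moreover have "0 \<le> (2 * (sinh x)\<^sup>2 - 1) / 1.305 + 6 + cosh x - pi - pi * cosh x"
  proof -
    have "pi * (1 + cosh x) \<le> 63/20 * (1 + cosh x)" using hyp pi_bounds by (intro mult_right_mono) auto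
    moreover have "(sinh x)\<^sup>2 = (cosh x)\<^sup>2 - 1" using cosh_square_eq[of x] by simp
    moreover have "0 \<le> (cosh x - 31/25) * (cosh x - 1)" using hyp by simp
    then have "56/25 * cosh x - 31/25 \<le> (cosh x)\<^sup>2" unfolding power2_eq_square by argo
    moreover have "31/25 \<le> cosh x" using hyp by simp
    ultimately have "0 \<le> (2 * (sinh x)\<^sup>2 - 1) * (200/261) + 6 + cosh x - pi - pi * cosh x" by argo
    then show ?thesis by simp
  qed
  then have "0 \<le> sinh x * ((2 * (sinh x)\<^sup>2 - 1) / 1.305 + 6 + cosh x - pi - pi * cosh x)"
    using assms(1) by (intro mult_nonneg_nonneg) auto
  ultimately show ?thesis by (simp add: algebra_simps)
qed

lemma abs_denom_re_1_05: "\<bar>denom_re 1.05\<bar> \<le> 6 * (crossover - cosh 1.05)"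
proof -
  have "3.1415926 * 3.1415926 \<le> pi * pi" "pi * pi \<le> 3.1415927 * 3.1415927"
    using pi_bounds by (intro mult_mono; simp)+
  moreover have "1.253856 * 1.603794 \<le> sinh (1.05::real) * cosh 1.05"
    "sinh (1.05::real) * cosh 1.05 \<le> 1.253857 * 1.603795"
    using cosh_sinh_1_05 by (intro mult_mono; simp)+
  moreover have "3.1415926 * (2.603794 * 2.603794) \<le> pi * ((1 + cosh 1.05) * (1 + cosh 1.05))"
    "pi * ((1 + cosh 1.05) * (1 + cosh 1.05)) \<le> 3.1415927 * (2.603795 * 2.603795)"
    using pi_bounds cosh_sinh_1_05 by (intro mult_mono; simp)+
  moreover have "denom_re 1.05 = pi * pi - 1.1025 + 1.05 * (sinh 1.05 * cosh 1.05) -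
      pi * ((1 + cosh 1.05) * (1 + cosh 1.05)) / 2"
    by (simp add: denom_re_def power2_eq_square)
  moreover have "\<bar>a - 1.1025 + 1.05 * b - c / 2\<bar> \<le> 6 * (crossover - 1.603795)"
    if "3.1415926 * 3.1415926 \<le> a" "a \<le> 3.1415927 * 3.1415927"
      "1.253856 * 1.603794 \<le> b" "b \<le> 1.253857 * 1.603795"
      "3.1415926 * (2.603794 * 2.603794) \<le> c" "c \<le> 3.1415927 * (2.603795 * 2.603795)" for a b c :: real
    using that by (simp add: abs_le_iff)
  ultimately have "\<bar>denom_re 1.05\<bar> \<le> 6 * (crossover - 1.603795)" by metis
  then show ?thesis using cosh_sinh_1_05 by simp
qed

lemma abs_denom_re_le:
  assumes s: "0.7 \<le> s" "s \<le> 1.05"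
  shows "\<bar>denom_re s\<bar> \<le> 6 * (crossover - cosh s)"
proof -
  have "\<sigma> * denom_re s \<le> 6 * (crossover - cosh s)" if \<sigma>: "\<sigma> = 1 \<or> \<sigma> = -1" for \<sigma> :: real
  proof -
    let ?f = "\<lambda>s. 6 * (crossover - cosh s) - \<sigma> * denom_re s"
    have "?f 1.05 \<le> ?f s"
    proof (rule deriv_nonpos_imp_antimono[OF _ _ s(2)])
      fix x assume "x \<in> {s..1.05}"
      then have x: "0.7 \<le> x" "x \<le> 1.05" using s by auto
      let ?d = "2 * x * (sinh x)\<^sup>2 - x + sinh x * (cosh x - pi - pi * cosh x)"
      show "(?f has_real_derivative - (6 * sinh x) - \<sigma> * ?d) (at x)"
        by (auto intro!: derivative_eq_intros denom_re_deriv)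
      show "- (6 * sinh x) - \<sigma> * ?d \<le> 0"
        using \<sigma> denom_re_deriv_le[OF x] denom_re_deriv_ge[OF x] by (elim disjE) simp_all
    qed
    moreover have "0 \<le> ?f 1.05" using \<sigma> abs_denom_re_1_05 by (auto simp: abs_le_iff)
    ultimately show ?thesis by linarith
  qed
  from this[of 1] this[of "-1"] show ?thesis by (simp add: abs_le_iff)
qed

lemma sinh_power4_ge:
  fixes s :: real
  assumes "0 \<le> s"
  shows "s ^ 4 + 2/3 * s ^ 6 \<le> sinh s ^ 4"
proof -
  have "- 1 \<le> s\<^sup>2/6" by (rule order_trans[of _ 0]) auto
  then have "1 + 4 * (s\<^sup>2/6) \<le> (1 + s\<^sup>2/6) ^ 4" using Bernoulli_inequality[of "s\<^sup>2/6" 4] by simp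
  then have "s ^ 4 * (1 + 4 * (s\<^sup>2/6)) \<le> s ^ 4 * (1 + s\<^sup>2/6) ^ 4" by (intro mult_left_mono) auto
  also have "\<dots> = (s * (1 + s\<^sup>2/6)) ^ 4" by (simp add: power_mult_distrib)
  also have "\<dots> \<le> sinh s ^ 4"
    using sinh_ge_cubic[OF assms] assms
    by (intro power_mono) (auto simp: algebra_simps power2_eq_square power3_eq_cube)
  finally show ?thesis by (simp add: algebra_simps flip: power_add)
qed

lemma g0_density_ge:
  assumes s: "0.7 \<le> s" "s \<le> 1.05"
  shows "0.02706 * (s ^ 4 + 2/3 * s ^ 6) \<le> g0_density s"
proof -
  define d where "d = crossover - cosh s"
  have d: "0 < d" using cosh_sinh_middle[OF s] by (simp add: d_def)
  have im: "0 < denom_im s" using denom_im_pos[of s] s by simp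
  have "(denom_re s)\<^sup>2 \<le> (6 * d)\<^sup>2"
    using abs_denom_re_le[OF s] d by (intro abs_le_square_iff[THEN iffD1]) (simp add: d_def)
  moreover have "(denom_im s)\<^sup>2 \<le> (5.8 * d)\<^sup>2"
    using denom_im_le[OF s] im by (intro power_mono) (simp_all add: d_def)
  ultimately have sq: "(denom_re s)\<^sup>2 + (denom_im s)\<^sup>2 \<le> 69.64 * d\<^sup>2"
    by (simp add: power_mult_distrib power_divide)
  have "0.02706 * (s ^ 4 + 2/3 * s ^ 6) \<le> (pi * 0.6 / 69.64) * sinh s ^ 4"
    using sinh_power4_ge[of s] pi_bounds s by (intro mult_mono) auto
  also have "\<dots> = pi * sinh s ^ 4 * (d * (0.6 * d)) / (69.64 * d\<^sup>2)"
    using d by (simp add: power2_eq_square)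
  also have "\<dots> \<le> pi * sinh s ^ 4 * (d * density_factor s) / ((denom_re s)\<^sup>2 + (denom_im s)\<^sup>2)"
    using sq im d density_factor_ge[OF s] density_factor_pos[of s] s
    by (intro frac_le mult_left_mono mult_nonneg_nonneg) (auto simp: d_def add_nonneg_pos)
  finally show ?thesis using g0_density_eq[of s] s by (simp add: d_def)
qed

section \<open>The box around the zeros of the denominator\<close>

lemma first_order_Taylor_bound:
  fixes f f' f'' :: "complex \<Rightarrow> complex"
  assumes "convex S" "w \<in> S" "z \<in> S"
    and "\<And>x. x \<in> S \<Longrightarrow> (f has_field_derivative f' x) (at x within S)"
    and "\<And>x. x \<in> S \<Longrightarrow> (f' has_field_derivative f'' x) (at x within S)"
    and "\<And>x. x \<in> S \<Longrightarrow> cmod (f'' x) \<le> B"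
  shows "cmod (f z - f w - f' w * (z - w)) \<le> B * (cmod (z - w))\<^sup>2"
proof -
  define D where "D i = (if i = 0 then f else if i = 1 then f' else f'')" for i :: nat
  have "cmod (D 0 z - (\<Sum>i\<le>1. D i w * (z - w) ^ i / fact i)) \<le> B * cmod (z - w) ^ Suc 1 / fact 1"
    by (rule complex_Taylor) (use assms in \<open>auto simp: D_def le_Suc_eq\<close>)
  then show ?thesis by (simp add: D_def diff_diff_eq power2_eq_square)
qed

definition numer_deriv :: "complex \<Rightarrow> complex" where
  "numer_deriv t = - (t * cos t) + t\<^sup>2 * sin t + sin t - of_real pi * ((1 - cos t) * sin t)"

definition numer_deriv2 :: "complex \<Rightarrow> complex" where
  "numer_deriv2 t = 3 * (t * sin t) + t\<^sup>2 * cos t - of_real pi * ((sin t)\<^sup>2 + (1 - cos t) * cos t)"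

definition denom_deriv :: "complex \<Rightarrow> complex" where
  "denom_deriv t = 2 * t - sin t * cos t - t * ((cos t)\<^sup>2 - (sin t)\<^sup>2)
     - of_real pi * ((1 - cos t) * sin t)"

definition denom_deriv2 :: "complex \<Rightarrow> complex" where
  "denom_deriv2 t = 2 - 2 * ((cos t)\<^sup>2 - (sin t)\<^sup>2) + 4 * (t * (sin t * cos t))
     - of_real pi * ((sin t)\<^sup>2 + (1 - cos t) * cos t)"

lemma numer_has_derivs:
  "(numer has_field_derivative numer_deriv t) (at t within S)"
  "(numer_deriv has_field_derivative numer_deriv2 t) (at t within S)"
  unfolding numer_def[abs_def] numer_deriv_def[abs_def] numer_deriv2_def
  by (auto intro!: derivative_eq_intros simp: algebra_simps power2_eq_square)

lemma denom_has_derivs: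
  "(denom has_field_derivative denom_deriv t) (at t within S)"
  "(denom_deriv has_field_derivative denom_deriv2 t) (at t within S)"
  unfolding denom_def[abs_def] denom_deriv_def[abs_def] denom_deriv2_def
  by (auto intro!: derivative_eq_intros simp: algebra_simps power2_eq_square)

abbreviation box_value :: real where "box_value \<equiv> 1.14"

definition shifted_numer :: "complex \<Rightarrow> complex" where
  "shifted_numer t = (of_real crossover + cos t) * numer t - of_real box_value * denom t"

definition shifted_numer_deriv :: "complex \<Rightarrow> complex" where
  "shifted_numer_deriv t = (of_real crossover + cos t) * numer_deriv t - sin t * numer t
     - of_real box_value * denom_deriv t"

definition shifted_numer_deriv2 :: "complex \<Rightarrow> complex" where
  "shifted_numer_deriv2 t = (of_real crossover + cos t) * numer_deriv2 t - 2 * (sin t * numer_deriv t)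
     - cos t * numer t - of_real box_value * denom_deriv2 t"

lemma shifted_numer_has_derivs:
  "(shifted_numer has_field_derivative shifted_numer_deriv t) (at t within S)"
  "(shifted_numer_deriv has_field_derivative shifted_numer_deriv2 t) (at t within S)"
  unfolding shifted_numer_def[abs_def] shifted_numer_deriv_def[abs_def] shifted_numer_deriv2_def
  by (auto intro!: derivative_eq_intros numer_has_derivs denom_has_derivs simp: algebra_simps)

abbreviation box_center :: complex where "box_center \<equiv> Complex pi 1.088"

definition zero_box :: "complex set" where
  "zero_box = cbox (Complex box_left box_bottom) (Complex (pi + 0.005) box_top)"

lemma convex_zero_box: "convex zero_box"
  unfolding zero_box_def by (rule convex_box)

lemma box_center_in: "box_center \<in> zero_box"
  by (simp add: zero_box_def in_cbox_complex_iff)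

lemma zero_box_coords:
  assumes "t \<in> zero_box"
  shows "\<bar>Re t - pi\<bar> \<le> 0.005" "\<bar>Im t - 1.088\<bar> \<le> 0.005"
  using assms unfolding zero_box_def in_cbox_complex_iff by (simp_all only: abs_le_iff) auto

lemma zero_box_dist_center:
  assumes "t \<in> zero_box"
  shows "(cmod (t - box_center))\<^sup>2 \<le> 0.00005" "cmod (t - box_center) \<le> 0.0071"
proof -
  have "\<bar>Re t - pi\<bar>\<^sup>2 \<le> 0.005\<^sup>2" "\<bar>Im t - 1.088\<bar>\<^sup>2 \<le> 0.005\<^sup>2"
    using zero_box_coords[OF assms] by (intro power_mono; simp)+
  then show sq: "(cmod (t - box_center))\<^sup>2 \<le> 0.00005" by (simp add: cmod_power2 power_divide)
  show "cmod (t - box_center) \<le> 0.0071"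
    by (rule power2_le_imp_le) (use sq in \<open>simp_all add: power_divide\<close>)
qed

lemma zero_box_norm_bounds:
  assumes "t \<in> zero_box"
  shows "cmod t \<le> 3.34" "cmod (sin t) \<le> 1.66" "cmod (cos t) \<le> 1.66" "cmod (1 - cos t) \<le> 1 + 1.66"
proof -
  have im: "0 \<le> Im t" "Im t \<le> box_top" and re: "\<bar>Re t\<bar> \<le> 3.15"
    using assms pi_bounds by (auto simp: zero_box_def in_cbox_complex_iff abs_le_iff)
  then show "cmod t \<le> 3.34"
    by (intro cmod_le_of_Re_Im[of _ "3.15" box_top]) (auto simp: power_divide)
  have "cosh (Im t) \<le> cosh box_top" using im by (simp add: cosh_real_nonneg_le_iff)
  then have "cosh (Im t) \<le> 1.66" by (rule order_trans) (use cosh_sinh_1_093 in simp)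
  then show "cmod (sin t) \<le> 1.66" "cmod (cos t) \<le> 1.66"
    using cmod_sin_le[of t] cmod_cos_le[of t] by linarith+
  then show "cmod (1 - cos t) \<le> 1 + 1.66" by (intro norm_triangle_mono_diff) auto
qed

lemma zero_box_diff_bound:
  assumes "\<And>t. t \<in> zero_box \<Longrightarrow> (f has_field_derivative f' t) (at t within zero_box)"
    and "\<And>t. t \<in> zero_box \<Longrightarrow> cmod (f' t) \<le> B" and t: "t \<in> zero_box"
  shows "cmod (f t - f box_center) \<le> B * 0.0071"
proof -
  have "cmod (f t - f box_center) \<le> B * cmod (t - box_center)"
    using field_differentiable_bound[OF convex_zero_box assms(1,2) t box_center_in] .
  also have "\<dots> \<le> B * 0.0071"
    using zero_box_dist_center(2)[OF t] order_trans[OF norm_ge_zero assms(2)[OF t]]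
    by (rule mult_left_mono)
  finally show ?thesis .
qed

lemma zero_box_cos_near:
  assumes "t \<in> zero_box"
  shows "cmod (cos t - cos box_center) \<le> 0.012"
proof -
  have "cmod (cos t - cos box_center) \<le> 1.66 * 0.0071"
    by (rule zero_box_diff_bound[where f' = "\<lambda>t. - sin t"])
       (use assms zero_box_norm_bounds in \<open>auto intro!: derivative_eq_intros\<close>)
  then show ?thesis by simp
qed

lemma mult_in_interval:
  fixes x y :: real
  assumes "x \<in> {a..b}" "y \<in> {c..d}" "0 \<le> a" "0 \<le> c" "l \<le> a * c" "b * d \<le> u"
  shows "x * y \<in> {l..u}"
proof -
  have "a * c \<le> x * y" "x * y \<le> b * d" using assms by (auto intro!: mult_mono)
  then show ?thesis using assms by simp
qed

abbreviation center_cosh :: real where "center_cosh \<equiv> cosh 1.088"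
abbreviation center_sinh :: real where "center_sinh \<equiv> sinh 1.088"

lemma center_products:
  "pi \<in> {3.1415926..3.1415927}"
  "center_cosh \<in> {1.65261..1.6526111}" "center_sinh \<in> {1.3157204..1.3157215}"
  "pi * pi \<in> {9.869604..9.869605}"
  "center_cosh * center_sinh \<in> {2.174372..2.174376}"
  "center_cosh * center_cosh \<in> {2.731119..2.731124}" "pi * center_cosh \<in> {5.191827..5.191831}"
  "pi * center_sinh \<in> {4.133457..4.133462}" "pi * pi * center_cosh \<in> {16.310606..16.310619}"
  "pi * pi * center_sinh \<in> {12.985639..12.985652}"
  "pi * (center_cosh * center_sinh) \<in> {6.83099..6.831004}"
  "pi * (center_cosh * center_cosh) \<in> {8.580063..8.58008}"
proof -
  show factors: "pi \<in> {3.1415926..3.1415927}" "center_cosh \<in> {1.65261..1.6526111}"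
    "center_sinh \<in> {1.3157204..1.3157215}"
    using pi_bounds cosh_sinh_1_088 by simp_all
  show products: "pi * pi \<in> {9.869604..9.869605}" "center_cosh * center_sinh \<in> {2.174372..2.174376}"
    "center_cosh * center_cosh \<in> {2.731119..2.731124}" "pi * center_cosh \<in> {5.191827..5.191831}"
    "pi * center_sinh \<in> {4.133457..4.133462}"
    by (rule mult_in_interval, (rule factors)+; simp)+
  show "pi * pi * center_cosh \<in> {16.310606..16.310619}" "pi * pi * center_sinh \<in> {12.985639..12.985652}"
    "pi * (center_cosh * center_sinh) \<in> {6.83099..6.831004}"
    "pi * (center_cosh * center_cosh) \<in> {8.580063..8.58008}"
    by (rule mult_in_interval, (rule factors products)+; simp)+
qed

lemma denom_center:
  "Re (denom box_center) \<in> {-0.0011..-0.00107}" "Im (denom box_center) \<in> {0.0051..0.00512}"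
proof -
  have "denom box_center = Complex
      (pi * pi - 1.088 * 1.088 + 1.088 * (center_cosh * center_sinh)
        - (pi + 2 * (pi * center_cosh) + pi * (center_cosh * center_cosh)) / 2)
      (2 * 1.088 * pi - pi * (center_cosh * center_sinh))"
    unfolding denom_right_line denom_re_def denom_im_def by (simp add: algebra_simps power2_eq_square)
  then show "Re (denom box_center) \<in> {-0.0011..-0.00107}" "Im (denom box_center) \<in> {0.0051..0.00512}"
    using center_products by (simp_all add: add_divide_distrib)
qed

lemma numer_center:
  "Re (numer box_center) \<in> {4.7331..4.7333}" "Im (numer box_center) \<in> {7.1639..7.164}"
proof -
  have "numer box_center = Complex
      (pi * pi * center_cosh - 1.088 * 1.088 * center_cosh + 1.088 * center_sinh
        - (pi + 2 * (pi * center_cosh) + pi * (center_cosh * center_cosh)) / 2)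
      (2 * 1.088 * (pi * center_cosh) - pi * center_sinh)"
    unfolding numer_right_line by (simp add: algebra_simps power2_eq_square)
  then show "Re (numer box_center) \<in> {4.7331..4.7333}" "Im (numer box_center) \<in> {7.1639..7.164}"
    using center_products by (simp_all add: add_divide_distrib)
qed

lemma numer_deriv_center:
  "Re (numer_deriv box_center) \<in> {14.186..14.187}" "Im (numer_deriv box_center) \<in> {0.018..0.019}"
proof -
  have "numer_deriv box_center = Complex (pi * center_cosh + 2 * 1.088 * (pi * center_sinh))
      (1.088 * center_cosh - pi * pi * center_sinh + 1.088 * 1.088 * center_sinh - center_sinh
        + pi * center_sinh + pi * (center_cosh * center_sinh))"
    unfolding numer_deriv_def cos_right_line sin_right_line
    by (simp add: complex_eq_iff algebra_simps power2_eq_square)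
  then show "Re (numer_deriv box_center) \<in> {14.186..14.187}"
    "Im (numer_deriv box_center) \<in> {0.018..0.019}"
    using center_products by (simp_all add: add_divide_distrib)
qed

lemma denom_deriv_center:
  "Re (denom_deriv box_center) \<in> {-7.7354..-7.7353}" "Im (denom_deriv box_center) \<in> {6.1111..6.1112}"
proof -
  have sinh_sq: "center_sinh * center_sinh = center_cosh * center_cosh - 1"
    using cosh_square_eq[of "1.088::real"] by (simp add: power2_eq_square)
  have "denom_deriv box_center = Complex
      (2 * pi - pi * (center_cosh * center_cosh + center_sinh * center_sinh))
      (2 * 1.088 - center_cosh * center_sinh
        - 1.088 * (center_cosh * center_cosh + center_sinh * center_sinh)
        + pi * center_sinh + pi * (center_cosh * center_sinh))"
    unfolding denom_deriv_def cos_right_line sin_right_line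
    by (simp add: complex_eq_iff algebra_simps power2_eq_square)
  then have "denom_deriv box_center = Complex
      (3 * pi - 2 * (pi * (center_cosh * center_cosh)))
      (3 * 1.088 - center_cosh * center_sinh - 2 * 1.088 * (center_cosh * center_cosh)
        + pi * center_sinh + pi * (center_cosh * center_sinh))"
    unfolding sinh_sq by (simp add: field_simps)
  then show "Re (denom_deriv box_center) \<in> {-7.7354..-7.7353}"
    "Im (denom_deriv box_center) \<in> {6.1111..6.1112}"
    using center_products by (simp_all add: add_divide_distrib)
qed

lemma cmod_numer_center: "cmod (numer box_center) \<le> 8.587"
  by (rule cmod_le_of_Re_Im[of _ "4.7333" "7.164"])
     (use numer_center in \<open>simp_all add: abs_le_iff power_divide\<close>)

lemma cmod_numer_deriv_center: "cmod (numer_deriv box_center) \<le> 14.188"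
  by (rule cmod_le_of_Re_Im[of _ "14.187" "0.019"])
     (use numer_deriv_center in \<open>simp_all add: abs_le_iff power_divide\<close>)

lemma cmod_denom_center: "cmod (denom box_center) \<le> 0.0054"
  by (rule cmod_le_of_Re_Im[of _ "0.0011" "0.00512"])
     (use denom_center in \<open>simp_all add: abs_le_iff power_divide\<close>)

lemma cmod_denom_deriv_center: "9.855 \<le> cmod (denom_deriv box_center)"
proof -
  have "7.7353\<^sup>2 \<le> (- Re (denom_deriv box_center))\<^sup>2" "6.1111\<^sup>2 \<le> (Im (denom_deriv box_center))\<^sup>2"
    using denom_deriv_center by (intro power_mono; simp)+
  then have "9.855\<^sup>2 \<le> (cmod (denom_deriv box_center))\<^sup>2" by (simp add: cmod_power2 power_divide)
  then show ?thesis by (rule power2_le_imp_le) simp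
qed

lemma cmod_shifted_numer_center:
  "cmod (shifted_numer box_center) \<le> 0.0045" (is ?value)
  "cmod (shifted_numer_deriv box_center) \<le> 0.955" (is ?deriv)
proof -
  define e where "e = crossover - center_cosh"
  have e: "e \<in> {0.0003889..0.00039}" using cosh_sinh_1_088 by (simp add: e_def)
  have cos_e: "of_real crossover + cos box_center = of_real e" by (simp add: cos_right_line e_def)
  have "e * Re (numer box_center) \<in> {0.00184..0.001847}"
    "e * Im (numer box_center) \<in> {0.002786..0.002795}"
    by (rule mult_in_interval[OF e numer_center(1)] mult_in_interval[OF e numer_center(2)]; simp)+
  moreover have "shifted_numer box_center = Complex
      (e * Re (numer box_center) - box_value * Re (denom box_center))
      (e * Im (numer box_center) - box_value * Im (denom box_center))"
    unfolding shifted_numer_def cos_e by (simp add: complex_eq_iff)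
  ultimately show ?value
    using denom_center
    by (intro cmod_le_of_Re_Im[of _ "0.00315" "0.00315"]) (simp_all add: abs_le_iff power_divide)
  have "e * Re (numer_deriv box_center) \<in> {0.0055..0.0056}"
    "e * Im (numer_deriv box_center) \<in> {0..0.00001}"
    by (rule mult_in_interval[OF e numer_deriv_center(1)]
        mult_in_interval[OF e numer_deriv_center(2)]; simp)+
  moreover have "center_sinh * Re (numer box_center) \<in> {6.227..6.228}"
    "center_sinh * Im (numer box_center) \<in> {9.4256..9.4259}"
    by (rule mult_in_interval[OF center_products(3) numer_center(1)]
        mult_in_interval[OF center_products(3) numer_center(2)]; simp)+
  moreover have "shifted_numer_deriv box_center = Complex
      (e * Re (numer_deriv box_center) - center_sinh * Im (numer box_center)
        - box_value * Re (denom_deriv box_center))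
      (e * Im (numer_deriv box_center) + center_sinh * Re (numer box_center)
        - box_value * Im (denom_deriv box_center))"
    unfolding shifted_numer_deriv_def cos_e sin_right_line by (simp add: complex_eq_iff)
  ultimately show ?deriv
    using denom_deriv_center
    by (intro cmod_le_of_Re_Im[of _ "0.603" "0.74"]) (simp_all add: abs_le_iff power_divide)
qed

lemma cmod_numer_deriv2_le:
  assumes "t \<in> zero_box"
  shows "cmod (numer_deriv2 t) \<le> 58"
proof -
  note t = zero_box_norm_bounds[OF assms]
  have "cmod (numer_deriv2 t) \<le> 3 * (3.34 * 1.66) + 3.34\<^sup>2 * 1.66
      + 3.1416 * (1.66\<^sup>2 + (1 + 1.66) * 1.66)"
    unfolding numer_deriv2_def using pi_bounds
    by (intro norm_triangle_mono norm_triangle_mono_diff norm_mult_mono norm_power_mono t) simp_all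
  also have "\<dots> \<le> 58" by (simp add: power_divide)
  finally show ?thesis .
qed

lemma cmod_denom_deriv2_le:
  assumes "t \<in> zero_box"
  shows "cmod (denom_deriv2 t) \<le> 73"
proof -
  note t = zero_box_norm_bounds[OF assms]
  have "cmod (denom_deriv2 t) \<le> 2 + 2 * (1.66\<^sup>2 + 1.66\<^sup>2) + 4 * (3.34 * (1.66 * 1.66))
      + 3.1416 * (1.66\<^sup>2 + (1 + 1.66) * 1.66)"
    unfolding denom_deriv2_def using pi_bounds
    by (intro norm_triangle_mono norm_triangle_mono_diff norm_mult_mono norm_power_mono t) simp_all
  also have "\<dots> \<le> 73" by (simp add: power_divide)
  finally show ?thesis .
qed

lemma cmod_numer_deriv_le:
  assumes "t \<in> zero_box"
  shows "cmod (numer_deriv t) \<le> 14.6"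
proof -
  have "cmod (numer_deriv t - numer_deriv box_center) \<le> 58 * 0.0071"
    by (rule zero_box_diff_bound[OF numer_has_derivs(2) cmod_numer_deriv2_le assms])
  from norm_triangle_mono[OF this cmod_numer_deriv_center] show ?thesis by simp
qed

lemma cmod_numer_le_zero_box:
  assumes "t \<in> zero_box"
  shows "cmod (numer t) \<le> 8.7"
proof -
  have "cmod (numer t - numer box_center) \<le> 14.6 * 0.0071"
    by (rule zero_box_diff_bound[OF numer_has_derivs(1) cmod_numer_deriv_le assms])
  from norm_triangle_mono[OF this cmod_numer_center] show ?thesis by simp
qed

lemma cmod_shifted_numer_deriv2_le:
  assumes "t \<in> zero_box"
  shows "cmod (shifted_numer_deriv2 t) \<le> 147"
proof -
  note t = zero_box_norm_bounds[OF assms]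
  have "cmod (of_real (crossover - center_cosh) + (cos t - cos box_center)) \<le> 0.001 + 0.012"
    using cosh_sinh_1_088 zero_box_cos_near[OF assms]
    by (intro norm_triangle_mono) (simp_all only: norm_of_real, simp)
  then have cos_t: "cmod (of_real crossover + cos t) \<le> 0.013" by (simp add: cos_right_line)
  have "cmod (shifted_numer_deriv2 t) \<le> 0.013 * 58 + 2 * (1.66 * 14.6) + 1.66 * 8.7 + box_value * 73"
    unfolding shifted_numer_deriv2_def
    by (intro norm_triangle_mono_diff norm_mult_mono t cos_t cmod_numer_deriv2_le cmod_denom_deriv2_le
        cmod_numer_deriv_le cmod_numer_le_zero_box assms) simp_all
  also have "\<dots> \<le> 147" by simp
  finally show ?thesis .
qed

lemma denom_Taylor_bound:
  assumes "t \<in> zero_box"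
  shows "cmod (denom t - denom box_center - denom_deriv box_center * (t - box_center))
    \<le> 73 * (cmod (t - box_center))\<^sup>2"
  by (rule first_order_Taylor_bound[OF convex_zero_box box_center_in assms denom_has_derivs
      cmod_denom_deriv2_le])

lemma shifted_numer_Taylor_bound:
  assumes "t \<in> zero_box"
  shows "cmod (shifted_numer t - shifted_numer box_center -
      shifted_numer_deriv box_center * (t - box_center)) \<le> 147 * (cmod (t - box_center))\<^sup>2"
  by (rule first_order_Taylor_bound[OF convex_zero_box box_center_in assms shifted_numer_has_derivs
      cmod_shifted_numer_deriv2_le])

definition detour :: "complex set" where
  "detour = {t \<in> zero_box. Re t \<le> pi \<and> (Re t = box_left \<or> Im t = box_bottom \<or> Im t = box_top)}"

lemma detour_dist_center:
  assumes "t \<in> detour"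
  shows "0.005 \<le> cmod (t - box_center)"
proof -
  have "\<bar>Re (t - box_center)\<bar> \<ge> 0.005 \<or> \<bar>Im (t - box_center)\<bar> \<ge> 0.005"
    using assms by (auto simp: detour_def)
  then show ?thesis
    using abs_Re_le_cmod[of "t - box_center"] abs_Im_le_cmod[of "t - box_center"] by auto
qed

lemma shifted_numer_le_denom_on_detour:
  assumes "t \<in> detour"
  shows "cmod (shifted_numer t) \<le> 0.33 * cmod (denom t)" "denom t \<noteq> 0"
proof -
  define r where "r = cmod (t - box_center)"
  have box: "t \<in> zero_box" using assms by (simp add: detour_def)
  have r: "5/1000 \<le> r" "r \<le> 71/10000"
    using detour_dist_center[OF assms] zero_box_dist_center(2)[OF box] by (simp_all add: r_def)
  then have "0 \<le> (r - 5/1000) * (71/10000 - r)" by simp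
  then have r_sq: "r\<^sup>2 \<le> 121/10000 * r - 355/10000000" unfolding power2_eq_square by argo
  have linear: "cmod (w * (t - box_center)) = cmod w * r" for w by (simp add: norm_mult r_def)
  have "9.855 * r \<le> cmod (denom_deriv box_center * (t - box_center))"
    unfolding linear using cmod_denom_deriv_center r by (intro mult_right_mono) auto
  also have "\<dots> = cmod (denom t - denom box_center -
      (denom t - denom box_center - denom_deriv box_center * (t - box_center)))"
    by simp
  also have "\<dots> \<le> cmod (denom t) + 0.0054 + 73 * r\<^sup>2"
    using denom_Taylor_bound[OF box] cmod_denom_center
    by (intro norm_triangle_mono_diff) (simp_all add: r_def)
  finally have denom: "9.855 * r \<le> cmod (denom t) + 0.0054 + 73 * r\<^sup>2" .
  have "cmod (shifted_numer_deriv box_center * (t - box_center)) \<le> 0.955 * r"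
    unfolding linear using cmod_shifted_numer_center(2) r by (intro mult_right_mono) auto
  from norm_triangle_mono[OF norm_triangle_mono[OF cmod_shifted_numer_center(1) this]
      shifted_numer_Taylor_bound[OF box]]
  have numer: "cmod (shifted_numer t) \<le> 0.0045 + 0.955 * r + 147 * r\<^sup>2" by (simp add: r_def)
  have "n \<le> 0.33 * d \<and> 0 < d" if "9.855 * r \<le> d + 0.0054 + 73 * q" "n \<le> 0.0045 + 0.955 * r + 147 * q"
    "q \<le> 121/10000 * r - 355/10000000" for n d q
    using that r by simp
  from this[OF denom numer r_sq]
  show "cmod (shifted_numer t) \<le> 0.33 * cmod (denom t)" "denom t \<noteq> 0" by auto
qed

lemma denom_linear_bound:
  assumes "t \<in> zero_box"
  shows "cmod (denom t - denom_deriv box_center * (t - box_center)) \<le> 0.00905"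
proof -
  have "cmod (denom box_center + (denom t - denom box_center - denom_deriv box_center * (t - box_center)))
      \<le> 0.0054 + 73 * 0.00005"
    using denom_Taylor_bound[OF assms] zero_box_dist_center(1)[OF assms] cmod_denom_center
    by (intro norm_triangle_mono) auto
  then show ?thesis by simp
qed

lemma linear_forms_on_box_boundary:
  fixes P Q y z :: real
  assumes P: "P \<in> {7.7353..7.7354}" and Q: "Q \<in> {6.1111..6.1112}"
    and y: "y \<in> {0..0.005}" and z: "z \<in> {- 0.005..0.005}"
    and side: "y = 0.005 \<or> z = - 0.005 \<or> z = 0.005"
  shows "0.03 \<le> P * y - Q * z \<or> 0.046 \<le> (P + 2 * Q) * y + (2 * P - Q) * z"
  using side
proof (elim disjE)
  assume z: "z = - 0.005"
  have "0 \<le> P * y" "0.03 \<le> Q * 0.005" using P Q y by simp_all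
  then show ?thesis unfolding z by simp
next
  assume z: "z = 0.005"
  have "0 \<le> (P + 2 * Q) * y" "0.046 \<le> (2 * P - Q) * 0.005" using P Q y by simp_all
  then show ?thesis unfolding z by linarith
next
  assume y: "y = 0.005"
  have "(2 * P - Q) * (- 0.005) \<le> (2 * P - Q) * z" using P Q z by (intro mult_left_mono) auto
  moreover have "0.046 \<le> (P + 2 * Q) * 0.005 + (2 * P - Q) * (- 0.005)"
    using P Q by (simp add: field_simps)
  ultimately show ?thesis unfolding y by linarith
qed

lemma denom_half_planes_on_detour:
  assumes "t \<in> detour"
  shows "0 < Re (denom t) \<or> 0 < Re (denom t) - 2 * Im (denom t)"
proof -
  define y where "y = pi - Re t"
  define z where "z = Im t - 1.088"
  define E where "E = denom t - denom_deriv box_center * (t - box_center)"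
  define P where "P = - Re (denom_deriv box_center)"
  define Q where "Q = Im (denom_deriv box_center)"
  have "cmod E \<le> 0.00905" using denom_linear_bound assms by (simp add: E_def detour_def)
  then have E: "\<bar>Re E\<bar> \<le> 0.00905" "\<bar>Im E\<bar> \<le> 0.00905"
    using abs_Re_le_cmod[of E] abs_Im_le_cmod[of E] by linarith+
  have "denom t = E + denom_deriv box_center * Complex (- y) z"
    by (simp add: E_def y_def z_def complex_eq_iff)
  then have Re: "Re (denom t) = Re E + (P * y - Q * z)"
    and Re_Im: "Re (denom t) - 2 * Im (denom t) = Re E - 2 * Im E + ((P + 2 * Q) * y + (2 * P - Q) * z)"
    by (simp_all add: P_def Q_def algebra_simps)
  have "0.03 \<le> P * y - Q * z \<or> 0.046 \<le> (P + 2 * Q) * y + (2 * P - Q) * z"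
    using assms denom_deriv_center
    by (intro linear_forms_on_box_boundary)
       (auto simp: P_def Q_def y_def z_def detour_def zero_box_def in_cbox_complex_iff)
  then show ?thesis unfolding Re_Im unfolding Re using E by (auto simp: abs_le_iff)
qed

lemma zero_box_versine_sq:
  assumes "t \<in> zero_box"
  shows "6.7 \<le> Re ((1 - cos t)\<^sup>2)" "\<bar>Im ((1 - cos t)\<^sup>2)\<bar> \<le> 0.07"
proof -
  define q where "q = 1 - cos t"
  have "q - of_real (1 + center_cosh) = - (cos t - cos box_center)" by (simp add: q_def cos_right_line)
  then have "cmod (q - of_real (1 + center_cosh)) \<le> 0.012"
    using zero_box_cos_near[OF assms] by (simp only: norm_minus_cancel)
  then have "\<bar>Re q - (1 + center_cosh)\<bar> \<le> 0.012" and Im: "\<bar>Im q\<bar> \<le> 0.012"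
    using abs_Re_le_cmod[of "q - of_real (1 + center_cosh)"]
      abs_Im_le_cmod[of "q - of_real (1 + center_cosh)"]
    by simp_all
  then have "Re q - (1 + center_cosh) \<le> 0.012" "- 0.012 \<le> Re q - (1 + center_cosh)" by linarith+
  then have Re: "2.6 \<le> Re q" "Re q \<le> 2.7" using cosh_sinh_1_088 by auto
  have "2.6 * 2.6 \<le> Re q * Re q" "\<bar>Im q\<bar> * \<bar>Im q\<bar> \<le> 0.012 * 0.012" "\<bar>Im q\<bar> * \<bar>Re q\<bar> \<le> 0.012 * 2.7"
    using Re Im by (intro mult_mono; simp)+
  then show "6.7 \<le> Re ((1 - cos t)\<^sup>2)" "\<bar>Im ((1 - cos t)\<^sup>2)\<bar> \<le> 0.07"
    unfolding q_def[symmetric] by (simp_all add: power2_eq_square abs_mult)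
qed

lemma denom_over_versine_sq_on_detour:
  assumes "t \<in> detour"
  shows "denom t / (1 - cos t)\<^sup>2 \<notin> \<real>\<^sub>\<le>\<^sub>0"
proof
  define q where "q = (1 - cos t)\<^sup>2"
  assume "denom t / (1 - cos t)\<^sup>2 \<in> \<real>\<^sub>\<le>\<^sub>0"
  then obtain l where l: "denom t / q = - of_real l" "0 \<le> l"
    unfolding q_def[symmetric]
    by (elim nonpos_Reals_cases) (metis minus_minus neg_0_le_iff_le of_real_minus)
  have q: "6.7 \<le> Re q" "\<bar>Im q\<bar> \<le> 0.07"
    using zero_box_versine_sq assms by (auto simp: q_def detour_def)
  then have "q \<noteq> 0" by auto
  then have "denom t = - of_real l * q" using l(1) by (simp add: field_simps)
  then have "Re (denom t) = - (l * Re q)" "Re (denom t) - 2 * Im (denom t) = - (l * (Re q - 2 * Im q))"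
    by (simp_all add: algebra_simps)
  moreover have "0 \<le> l * Re q" "0 \<le> l * (Re q - 2 * Im q)"
    using l(2) q by (auto intro!: mult_nonneg_nonneg simp: abs_le_iff)
  ultimately show False using denom_half_planes_on_detour[OF assms] by linarith
qed

section \<open>The denominator has no other zeros\<close>

lemma holomorphic_avoids_nonpos_Reals:
  assumes hol: "f holomorphic_on S" and S: "open S" "connected S" and nonconst: "\<not> f constant_on S"
    and K: "compact K" "K \<subseteq> S"
    and frontier: "\<And>t. t \<in> frontier K \<Longrightarrow> f t \<notin> \<real>\<^sub>\<le>\<^sub>0"
    and "t \<in> K"
  shows "f t \<notin> \<real>\<^sub>\<le>\<^sub>0"
proof
  assume t: "f t \<in> \<real>\<^sub>\<le>\<^sub>0"
  define Z where "Z = K \<inter> f -` \<real>\<^sub>\<le>\<^sub>0"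
  have cont: "continuous_on K f"
    using holomorphic_on_imp_continuous_on[OF hol] K(2) by (rule continuous_on_subset)
  have "compact Z"
    unfolding Z_def using cont K(1) closed_nonpos_Reals_complex
    by (metis closedin_compact continuous_closedin_preimage)
  moreover have "continuous_on Z (\<lambda>t. Re (f t))"
    by (intro continuous_intros continuous_on_subset[OF cont]) (simp add: Z_def)
  ultimately obtain z where z: "z \<in> Z" "\<And>w. w \<in> Z \<Longrightarrow> Re (f z) \<le> Re (f w)"
    using continuous_attains_inf[of Z "\<lambda>t. Re (f t)"] t \<open>t \<in> K\<close> by (auto simp: Z_def)
  have "z \<in> interior K"
    using z(1) frontier[of z] K(1) by (auto simp: Z_def frontier_def compact_imp_closed)
  moreover have "open (f ` interior K)"
    using interior_subset K(2) by (intro open_mapping_thm[OF hol S open_interior _ nonconst]) blast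
  ultimately obtain e where e: "e > 0" "ball (f z) e \<subseteq> f ` interior K"
    by (meson imageI open_contains_ball)
  have "f z - of_real (e/2) \<in> ball (f z) e" using e(1) by (simp add: dist_norm norm_minus_commute)
  then obtain w where w: "w \<in> interior K" "f w = f z - of_real (e/2)"
    using e(2) by (metis imageE subsetD)
  then have "w \<in> Z"
    using z(1) e(1) interior_subset by (auto simp: Z_def complex_nonpos_Reals_iff)
  from z(2)[OF this] show False using w(2) e(1) by simp
qed

definition scaled_denom :: "complex \<Rightarrow> complex" where
  "scaled_denom t = denom_red t / versine_sq_red t"

lemma scaled_denom_eq: "t \<noteq> 0 \<Longrightarrow> scaled_denom t = denom t / (1 - cos t)\<^sup>2"
  by (simp add: scaled_denom_def denom_eq versine_sq_eq)

lemma versine_sq_red_nonzero: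
  assumes "\<bar>Re t\<bar> < 2 * pi"
  shows "versine_sq_red t \<noteq> 0"
proof (cases "t = 0")
  case True
  then show ?thesis by (simp add: versine_sq_red_def sinc_0)
next
  case False
  have "cos t \<noteq> 1"
  proof
    assume "cos t = 1"
    then obtain n :: int where n: "t = of_real (2 * pi * of_int n)"
      by (auto simp: cos_eq_1 algebra_simps)
    then have "2 * pi * \<bar>of_int n\<bar> < 2 * pi * 1" using assms by (simp add: abs_mult)
    then have "\<bar>real_of_int n\<bar> < 1" by (subst (asm) mult_less_cancel_left_pos) auto
    then have "n = 0" by simp
    with n False show False by simp
  qed
  then show ?thesis using versine_sq_eq[of t] by auto
qed

lemma scaled_denom_holomorphic: "scaled_denom holomorphic_on {t. \<bar>Re t\<bar> < 2 * pi}"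
  unfolding scaled_denom_def[abs_def]
  by (intro holomorphic_on_divide holomorphic_on_subset[OF denom_red_holomorphic]
      holomorphic_on_subset[OF versine_sq_red_holomorphic]) (auto simp: versine_sq_red_nonzero)

lemma scaled_denom_first_quadrant:
  assumes "scaled_denom t \<in> \<real>\<^sub>\<le>\<^sub>0"
  shows "scaled_denom (Complex \<bar>Re t\<bar> \<bar>Im t\<bar>) \<in> \<real>\<^sub>\<le>\<^sub>0"
proof (cases "t = 0")
  case True
  then have "Complex \<bar>Re t\<bar> \<bar>Im t\<bar> = t" by (simp add: complex_eq_iff)
  then show ?thesis using assms by simp
next
  case False
  have minus: "scaled_denom (- t) = scaled_denom t"
    and cnj: "scaled_denom (cnj t) = cnj (scaled_denom t)"
    if "t \<noteq> 0" for t
    using that by (simp_all add: scaled_denom_eq denom_even denom_cnj cnj_cos)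
  have "Complex \<bar>Re t\<bar> \<bar>Im t\<bar> \<in> {t, - t, cnj t, - cnj t}"
    by (auto simp: complex_eq_iff abs_if)
  then show ?thesis
    using assms minus[OF False] cnj[OF False] minus[of "cnj t"] False
    by (auto simp: complex_nonpos_Reals_iff)
qed

lemma scaled_denom_right_line:
  "scaled_denom (Complex pi s) = Complex (denom_re s / (1 + cosh s)\<^sup>2) (denom_im s / (1 + cosh s)\<^sup>2)"
proof -
  have "Complex pi s \<noteq> 0" by (simp add: complex_eq_iff)
  then have "scaled_denom (Complex pi s) = Complex (denom_re s) (denom_im s) / of_real ((1 + cosh s)\<^sup>2)"
    by (simp add: scaled_denom_eq denom_right_line cos_right_line)
  then show ?thesis by (simp only: complex_eq_iff Re_divide_of_real Im_divide_of_real complex.sel)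
qed

lemma scaled_denom_right_line_not_nonpos:
  assumes "0 \<le> s" "s \<le> box_bottom \<or> box_top \<le> s"
  shows "scaled_denom (Complex pi s) \<notin> \<real>\<^sub>\<le>\<^sub>0"
proof (cases "s = 0")
  case True
  have "0 < pi * (pi - 2)" using pi_gt3 by simp
  then show ?thesis
    unfolding True scaled_denom_right_line
    by (simp add: complex_nonpos_Reals_iff denom_re_def power2_eq_square algebra_simps)
next
  case False
  then have "denom_im s \<noteq> 0" using assms denom_im_pos[of s] denom_im_neg[of s] by auto
  moreover have "1 + cosh s \<noteq> 0" using cosh_real_ge_1[of s] by linarith
  ultimately show ?thesis unfolding scaled_denom_right_line by (simp add: complex_nonpos_Reals_iff)
qed

lemma scaled_denom_not_constant: "\<not> scaled_denom constant_on {t. \<bar>Re t\<bar> < 2 * pi}"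
proof
  assume "scaled_denom constant_on {t. \<bar>Re t\<bar> < 2 * pi}"
  moreover have "Complex pi 1 \<in> {t. \<bar>Re t\<bar> < 2 * pi}" "Complex pi 0 \<in> {t. \<bar>Re t\<bar> < 2 * pi}" by simp_all
  ultimately have "scaled_denom (Complex pi 1) = scaled_denom (Complex pi 0)"
    unfolding constant_on_def by metis
  then have "denom_im 1 / (1 + cosh 1)\<^sup>2 = 0"
    by (simp add: scaled_denom_right_line denom_im_def)
  moreover have "1 + cosh (1::real) \<noteq> 0" using cosh_real_ge_1[of 1] by linarith
  ultimately show False using denom_im_pos[of 1] by simp
qed

lemma scaled_denom_expansion:
  assumes "t \<noteq> 0" "cos t \<noteq> 1"
  shows "scaled_denom t = (t\<^sup>2 - \<i> * t * (2 * cos t - 1) + \<i> * t * exp (\<i> * t) * cos t) / (1 - cos t)\<^sup>2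
    + (- \<i> * t - of_real (pi/2))"
proof -
  define q where "q = 1 - cos t"
  have sin: "sin t = \<i> * cos t - \<i> * exp (\<i> * t)" by (simp add: exp_Euler algebra_simps)
  have cos_sq: "(cos t)\<^sup>2 = q\<^sup>2 + 2 * cos t - 1" by (simp add: q_def power2_eq_square algebra_simps)
  have "t * sin t * cos t = \<i> * t * (cos t)\<^sup>2 - \<i> * t * exp (\<i> * t) * cos t"
    unfolding sin by (simp add: algebra_simps power2_eq_square)
  then have "denom t = t\<^sup>2 - \<i> * t * (2 * cos t - 1) + \<i> * t * exp (\<i> * t) * cos t
      + q\<^sup>2 * (- \<i> * t - of_real (pi/2))"
    unfolding denom_def cos_sq q_def[symmetric] by (simp add: algebra_simps)
  then show ?thesis
    using assms by (simp add: scaled_denom_eq q_def[symmetric] add_divide_distrib) (simp add: q_def)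
qed

lemma eventually_Re_scaled_denom_pos:
  "\<forall>\<^sub>F R in at_top. \<forall>t. \<bar>Re t\<bar> \<le> pi \<longrightarrow> Im t = R \<longrightarrow> 0 < Re (scaled_denom t)"
proof -
  define B :: "real \<Rightarrow> real" where
    "B R = ((R + pi)\<^sup>2 + (R + pi) * (2 * cosh R + 1) + (R + pi) * 1 * cosh R) / (sinh R - 1)\<^sup>2" for R
  have "\<forall>\<^sub>F R in at_top. 0 < R - pi/2 - B R"
    unfolding B_def cosh_field_def sinh_field_def by real_asymp
  then show ?thesis
    using eventually_ge_at_top[of 2]
  proof (eventually_elim, intro allI impI)
    fix R t assume R: "0 < R - pi/2 - B R" "2 \<le> R" and t: "\<bar>Re t\<bar> \<le> pi" "Im t = R"
    let ?E = "t\<^sup>2 - \<i> * t * (2 * cos t - 1) + \<i> * t * exp (\<i> * t) * cos t"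
    have sinh: "2 \<le> sinh R" using sinh_ge_self[of R] R(2) by simp
    have norm_t: "cmod t \<le> R + pi" "cmod (\<i> * t) \<le> R + pi" "t \<noteq> 0"
      using cmod_le[of t] t R(2) by (auto simp: norm_mult)
    have cos_t: "cmod (cos t) \<le> cosh R" using cmod_cos_le[of t] t by simp
    have "sinh R \<le> cmod (cos t)" using cmod_cos_ge[of t] t sinh by simp
    then have versine: "sinh R - 1 \<le> cmod (1 - cos t)"
      using norm_triangle_ineq2[of "cos t" 1] by (simp add: norm_minus_commute)
    have "cmod (2 * cos t - 1) \<le> 2 * cosh R + 1" "cmod (exp (\<i> * t)) \<le> 1"
      using cos_t t R(2) by (auto intro!: norm_triangle_mono_diff simp: norm_mult)
    then have "cmod ?E \<le> (R + pi)\<^sup>2 + (R + pi) * (2 * cosh R + 1) + (R + pi) * 1 * cosh R"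
      by (intro norm_triangle_mono norm_triangle_mono_diff norm_mult_mono norm_power_mono norm_t cos_t)
        simp_all
    then have "cmod (?E / (1 - cos t)\<^sup>2) \<le> B R"
      unfolding B_def norm_divide norm_power using versine sinh R(2)
      by (intro frac_le power_mono) auto
    then have "- B R \<le> Re (?E / (1 - cos t)\<^sup>2)"
      using abs_Re_le_cmod[of "?E / (1 - cos t)\<^sup>2"] by linarith
    moreover have "cos t \<noteq> 1" using versine sinh by auto
    then have "Re (scaled_denom t) = Re (?E / (1 - cos t)\<^sup>2) + R - pi/2"
      using t by (simp add: scaled_denom_expansion norm_t(3))
    ultimately show "0 < Re (scaled_denom t)" using R(1) by linarith
  qed
qed

definition punctured_strip :: "complex set" where
  "punctured_strip = {t. \<bar>Re t\<bar> \<le> pi \<and> \<not> (box_left < \<bar>Re t\<bar> \<and> box_bottom < \<bar>Im t\<bar> \<and> \<bar>Im t\<bar> < box_top)}"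

lemma compact_truncated_punctured_strip: "compact (punctured_strip \<inter> {t. \<bar>Im t\<bar> \<le> R})"
proof -
  let ?K = "punctured_strip \<inter> {t. \<bar>Im t\<bar> \<le> R}"
  have "cmod t \<le> pi + R" if "t \<in> ?K" for t
    using that cmod_le[of t] by (auto simp: punctured_strip_def)
  then have "bounded ?K" unfolding bounded_iff by blast
  moreover have "?K = {t. \<bar>Re t\<bar> \<le> pi} \<inter> {t. \<bar>Im t\<bar> \<le> R} \<inter>
      ({t. \<bar>Re t\<bar> \<le> box_left} \<union> {t. \<bar>Im t\<bar> \<le> box_bottom} \<union> {t. box_top \<le> \<bar>Im t\<bar>})"
    by (auto simp: punctured_strip_def not_less)
  moreover have "closed \<dots>"
    by (intro closed_Int closed_Un closed_Collect_le continuous_intros)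
  ultimately show ?thesis by (simp add: compact_eq_bounded_closed)
qed

lemma frontier_truncated_punctured_strip:
  assumes t: "t \<in> frontier (punctured_strip \<inter> {t. \<bar>Im t\<bar> \<le> R})"
  shows "t \<in> punctured_strip" "\<bar>Re t\<bar> = pi \<or> \<bar>Im t\<bar> = R \<or> Complex \<bar>Re t\<bar> \<bar>Im t\<bar> \<in> detour"
proof -
  let ?K = "punctured_strip \<inter> {t. \<bar>Im t\<bar> \<le> R}"
  define U where "U = {t. \<bar>Re t\<bar> < pi} \<inter> {t. \<bar>Im t\<bar> < R} \<inter>
      ({t. \<bar>Re t\<bar> < box_left} \<union> {t. \<bar>Im t\<bar> < box_bottom} \<union> {t. box_top < \<bar>Im t\<bar>})"
  have "open U" unfolding U_def
    by (intro open_Int open_Un open_Collect_less continuous_intros)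
  moreover have "U \<subseteq> ?K" by (auto simp: U_def punctured_strip_def)
  ultimately have "t \<notin> U" using t interior_maximal by (auto simp: frontier_def)
  moreover have K: "t \<in> ?K"
    using t frontier_subset_closed[OF compact_imp_closed[OF compact_truncated_punctured_strip]] by blast
  ultimately show "\<bar>Re t\<bar> = pi \<or> \<bar>Im t\<bar> = R \<or> Complex \<bar>Re t\<bar> \<bar>Im t\<bar> \<in> detour"
    by (auto simp: U_def punctured_strip_def detour_def zero_box_def in_cbox_complex_iff)
  show "t \<in> punctured_strip" using K by simp
qed

lemma scaled_denom_frontier_not_nonpos:
  assumes frontier: "t \<in> frontier (punctured_strip \<inter> {t. \<bar>Im t\<bar> \<le> R})"
    and top: "\<And>w. \<lbrakk>\<bar>Re w\<bar> \<le> pi; Im w = R\<rbrakk> \<Longrightarrow> 0 < Re (scaled_denom w)"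
  shows "scaled_denom t \<notin> \<real>\<^sub>\<le>\<^sub>0"
proof -
  define w where "w = Complex \<bar>Re t\<bar> \<bar>Im t\<bar>"
  note strip = frontier_truncated_punctured_strip(1)[OF frontier]
  consider "\<bar>Re t\<bar> = pi" | "\<bar>Im t\<bar> = R" | "w \<in> detour"
    using frontier_truncated_punctured_strip(2)[OF frontier] by (auto simp: w_def)
  then have "scaled_denom w \<notin> \<real>\<^sub>\<le>\<^sub>0"
  proof cases
    case 1
    then show ?thesis
      using scaled_denom_right_line_not_nonpos[of "\<bar>Im t\<bar>"] strip by (auto simp: w_def punctured_strip_def)
  next
    case 2
    then have "0 < Re (scaled_denom w)"
      using strip by (intro top) (auto simp: w_def punctured_strip_def)
    then show ?thesis by (auto simp: complex_nonpos_Reals_iff)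
  next
    case 3
    then have "w \<noteq> 0" by (auto simp: detour_def zero_box_def in_cbox_complex_iff)
    then show ?thesis using denom_over_versine_sq_on_detour[OF 3] by (simp add: scaled_denom_eq)
  qed
  then show ?thesis using scaled_denom_first_quadrant by (auto simp: w_def)
qed

theorem scaled_denom_not_nonpos:
  assumes "t \<in> punctured_strip"
  shows "scaled_denom t \<notin> \<real>\<^sub>\<le>\<^sub>0"
proof -
  obtain R where R: "\<bar>Im t\<bar> \<le> R" "\<And>w. \<lbrakk>\<bar>Re w\<bar> \<le> pi; Im w = R\<rbrakk> \<Longrightarrow> 0 < Re (scaled_denom w)"
    using eventually_conj[OF eventually_Re_scaled_denom_pos eventually_ge_at_top[of "\<bar>Im t\<bar>"]]
      eventually_happens'[OF trivial_limit_at_top_linorder] by blast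
  define S :: "complex set" where "S = {t. \<bar>Re t\<bar> < 2 * pi}"
  have "S = {t. Re t < 2 * pi} \<inter> {t. Re t > - (2 * pi)}" by (auto simp: S_def)
  then have S: "open S" "connected S"
    by (auto intro!: convex_connected convex_Int open_Int open_halfspace_Re_lt open_halfspace_Re_gt
        convex_halfspace_Re_lt convex_halfspace_Re_gt)
  show ?thesis
  proof (rule holomorphic_avoids_nonpos_Reals[where f = scaled_denom, OF _ S _ compact_truncated_punctured_strip])
    show "scaled_denom holomorphic_on S" "\<not> scaled_denom constant_on S"
      unfolding S_def by (fact scaled_denom_holomorphic scaled_denom_not_constant)+
    show "punctured_strip \<inter> {t. \<bar>Im t\<bar> \<le> R} \<subseteq> S"
      using pi_gt_zero by (auto simp: S_def punctured_strip_def simp del: pi_gt_zero)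
    show "scaled_denom w \<notin> \<real>\<^sub>\<le>\<^sub>0" if "w \<in> frontier (punctured_strip \<inter> {t. \<bar>Im t\<bar> \<le> R})" for w
      using that R(2) by (rule scaled_denom_frontier_not_nonpos)
  qed (use assms R(1) in simp)
qed

corollary denom_red_nonzero: "t \<in> punctured_strip \<Longrightarrow> denom_red t \<noteq> 0"
  using scaled_denom_not_nonpos[of t] by (auto simp: scaled_denom_def)

section \<open>The function \<open>g0\<close>\<close>

definition g0_lift :: "complex \<Rightarrow> complex" where
  "g0_lift t = numer_red t / denom_red t"

definition g0_shifted_lift :: "complex \<Rightarrow> complex" where
  "g0_shifted_lift t = (of_real crossover + cos t) * g0_lift t - of_real box_value"

lemma g0_lift_eq: "t \<noteq> 0 \<Longrightarrow> g0_lift t = numer t / denom t"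
  by (simp add: g0_lift_def numer_eq denom_eq)

lemma strip_subset_punctured_strip: "\<lbrakk>0 \<le> Re t; Re t \<le> box_left\<rbrakk> \<Longrightarrow> t \<in> punctured_strip"
  by (auto simp: punctured_strip_def)

lemma disc_preimage_subset_punctured_strip:
  assumes "0 < Re t" "Re t < pi" "cmod (cos t) < 1"
  shows "t \<in> punctured_strip"
proof -
  have "\<bar>Im t\<bar> \<le> \<bar>sinh (Im t)\<bar>" using sinh_ge_self[of "\<bar>Im t\<bar>"] by simp
  also have "\<dots> < 1" using cmod_cos_ge[of t] assms(3) by linarith
  finally show ?thesis using assms(1,2) by (auto simp: punctured_strip_def)
qed

lemma g0_lift_holomorphic: "g0_lift holomorphic_on {t. denom_red t \<noteq> 0}"
  unfolding g0_lift_def[abs_def]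
  by (intro holomorphic_on_divide holomorphic_on_subset[OF numer_red_holomorphic]
      holomorphic_on_subset[OF denom_red_holomorphic]) auto

lemma open_denom_red_nonzero: "open {t. denom_red t \<noteq> 0}"
  using holomorphic_on_imp_continuous_on[OF denom_red_holomorphic] by (intro open_Collect_neq) auto

lemma half_pi_less_box_left: "pi/2 < box_left"
  using pi_bounds by simp

interpretation g0: even_strip_function g0_lift "{t. denom_red t \<noteq> 0}" box_left
proof
  show "t \<in> {t. denom_red t \<noteq> 0}" if "0 \<le> Re t" "Re t \<le> box_left" for t
    using denom_red_nonzero strip_subset_punctured_strip[OF that] by simp
  show "t \<in> {t. denom_red t \<noteq> 0}" if "0 < Re t" "Re t < pi" "cmod (cos t) < 1" for t
    using denom_red_nonzero disc_preimage_subset_punctured_strip[OF that] by simp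
  show "pi/2 < box_left" by (rule half_pi_less_box_left)
qed (simp_all add: g0_lift_holomorphic open_denom_red_nonzero
    g0_lift_def numer_red_even denom_red_even numer_red_cnj denom_red_cnj)

interpretation g0_shifted: even_strip_function g0_shifted_lift "{t. denom_red t \<noteq> 0}" box_left
proof
  show "g0_shifted_lift holomorphic_on {t. denom_red t \<noteq> 0}"
    unfolding g0_shifted_lift_def[abs_def] by (intro holomorphic_intros g0.holomorphic)
  show "pi/2 < box_left" by (rule half_pi_less_box_left)
qed (use g0.strip g0.disc in \<open>simp_all add: open_denom_red_nonzero
    g0_shifted_lift_def g0.even g0.cnj cnj_cos\<close>)

lemma cos_descent_g0_shifted_lift:
  "cos_descent g0_shifted_lift =
     (\<lambda>z. (of_real crossover - z) * cos_descent g0_lift z - of_real box_value)"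
  by (simp add: fun_eq_iff cos_descent_def g0_shifted_lift_def)

abbreviation g0_kernel :: "nat \<Rightarrow> complex \<Rightarrow> complex" where
  "g0_kernel \<equiv> cos_kernel g0_shifted_lift"

lemma g0_kernel_holomorphic:
  assumes "\<And>t. t \<in> S \<Longrightarrow> t \<in> punctured_strip \<and> pi/2 < Re t"
  shows "g0_kernel n holomorphic_on S"
proof (rule cos_kernel_holomorphic)
  show "g0_shifted_lift holomorphic_on S"
    using assms denom_red_nonzero by (intro holomorphic_on_subset[OF g0_shifted.holomorphic]) auto
  show "cos t \<noteq> 0" if "t \<in> S" for t
    using assms[OF that]
    by (intro cos_nonzero_strip) (auto simp: punctured_strip_def intro: le_less_trans)
qed

lemma Re_g0_kernel_right_line:
  "Re (g0_kernel n (Complex pi s)) = g0_density s / cosh s ^ Suc n"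
proof -
  have "Complex pi s \<noteq> 0" by (simp add: complex_eq_iff)
  then have "g0_shifted_lift (Complex pi s) =
      of_real (crossover - cosh s) * (numer (Complex pi s) / denom (Complex pi s)) - of_real box_value"
    by (simp add: g0_shifted_lift_def g0_lift_eq cos_right_line)
  then have "Im (g0_shifted_lift (Complex pi s)) =
      (crossover - cosh s) * Im (numer (Complex pi s) / denom (Complex pi s))"
    by (simp only: minus_complex.sel times_complex.sel Re_complex_of_real Im_complex_of_real
        mult_zero_left add_0_right diff_zero)
  then show ?thesis unfolding Re_cos_kernel_right_line by (simp add: g0_density_def)
qed

lemma cmod_g0_shifted_lift_on_detour:
  assumes "t \<in> detour"
  shows "cmod (g0_shifted_lift t) \<le> 0.33"
proof -
  have "t \<noteq> 0" using assms by (auto simp: detour_def zero_box_def in_cbox_complex_iff)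
  then have "g0_shifted_lift t = shifted_numer t / denom t"
    using shifted_numer_le_denom_on_detour(2)[OF assms]
    by (simp add: g0_shifted_lift_def shifted_numer_def g0_lift_eq field_simps)
  then show ?thesis
    using shifted_numer_le_denom_on_detour[OF assms] by (simp add: norm_divide divide_le_eq)
qed

lemma sin_cos_on_detour:
  assumes "t \<in> detour"
  shows "cmod (sin t) \<le> 1.3245" "1.646 \<le> cmod (cos t)"
proof -
  have re: "box_left \<le> Re t" "Re t \<le> pi" and im: "box_bottom \<le> Im t" "Im t \<le> box_top"
    using assms by (auto simp: detour_def zero_box_def in_cbox_complex_iff)
  have "\<bar>sin (Re t)\<bar> = \<bar>sin (pi - Re t)\<bar>" by simp
  also have "\<dots> \<le> \<bar>pi - Re t\<bar>" by (rule abs_sin_x_le_abs_x)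
  finally have "\<bar>sin (Re t)\<bar>\<^sup>2 \<le> 0.005\<^sup>2" using re by (intro power_mono) auto
  then have sin_sq: "(sin (Re t))\<^sup>2 \<le> 0.005\<^sup>2" by simp
  have "sinh (Im t) \<le> sinh box_top" using im by (simp only: sinh_real_le_iff)
  then have "sinh (Im t) \<le> 1.324001" by (rule order_trans) (use cosh_sinh_1_093 in simp)
  then have "(sinh (Im t))\<^sup>2 \<le> 1.324001\<^sup>2" using im by (intro power_mono) auto
  then have "(cmod (sin t))\<^sup>2 \<le> 1.3245\<^sup>2" using sin_sq by (simp add: cmod_sin_squared power_divide)
  then show "cmod (sin t) \<le> 1.3245" by (rule power2_le_imp_le) simp
  have "cosh box_bottom \<le> cosh (Im t)" using im by (simp add: cosh_real_nonneg_le_iff)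
  then have "1.646052 \<le> cosh (Im t)" by (rule order_trans[rotated]) (use cosh_sinh_1_083 in simp)
  then have "1.646052\<^sup>2 \<le> (cosh (Im t))\<^sup>2" by (intro power_mono) auto
  moreover have "(cmod (cos t))\<^sup>2 = (cosh (Im t))\<^sup>2 - (sin (Re t))\<^sup>2"
    by (simp add: cmod_cos_squared cosh_square_eq cos_squared_eq)
  ultimately have "1.646\<^sup>2 \<le> (cmod (cos t))\<^sup>2" using sin_sq by (simp add: power_divide)
  then show "1.646 \<le> cmod (cos t)" by (rule power2_le_imp_le) simp
qed

definition detour_bound :: "nat \<Rightarrow> real" where
  "detour_bound n = 0.33 * 1.3245 / 1.646 ^ Suc n"

lemma detour_integral_bound:
  assumes sub: "closed_segment z w \<subseteq> detour"
  shows "cmod (segment_integral z w (g0_kernel n)) \<le> detour_bound n * cmod (w - z)"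
proof (rule contour_integral_bound_linepath)
  have "t \<in> punctured_strip \<and> pi/2 < Re t" if "t \<in> detour" for t
    using that half_pi_less_box_left
    by (auto simp: detour_def zero_box_def in_cbox_complex_iff punctured_strip_def)
  then show "g0_kernel n contour_integrable_on linepath z w"
    using sub
    by (intro contour_integrable_continuous_linepath holomorphic_on_imp_continuous_on
        g0_kernel_holomorphic) auto
  show "0 \<le> detour_bound n" by (simp add: detour_bound_def)
  show "cmod (g0_kernel n t) \<le> detour_bound n" if "t \<in> closed_segment z w" for t
    unfolding detour_bound_def using that sub
    by (intro cmod_cos_kernel_le cmod_g0_shifted_lift_on_detour sin_cos_on_detour) auto
qed

definition main_weight :: real where
  "main_weight = 0.02706 * ((1.05 ^ 5 - 0.7 ^ 5) / 5 + 2/21 * (1.05 ^ 7 - 0.7 ^ 7))"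

lemma density_minorant_has_integral:
  "((\<lambda>s. 0.02706 * (s ^ 4 + 2/3 * s ^ 6)) has_integral main_weight) {0.7..1.05}"
proof -
  have "((\<lambda>s. 0.02706 * (s ^ 4 + 2/3 * s ^ 6)) has_integral
      0.02706 * (1.05 ^ 5 / 5 + 2/21 * 1.05 ^ 7) -
      0.02706 * (0.7 ^ 5 / 5 + 2/21 * 0.7 ^ 7)) {0.7..1.05::real}"
    by (rule fundamental_theorem_of_calculus)
       (auto intro!: derivative_eq_intros simp: has_real_derivative_iff_has_vector_derivative[symmetric])
  then show ?thesis by (simp add: main_weight_def algebra_simps diff_divide_distrib)
qed

lemma detour_contribution_le_main_weight: "0.02 * detour_bound n \<le> main_weight / 1.646 ^ Suc n"
proof -
  have "0.02 * (0.33 * 1.3245) \<le> main_weight" by (simp add: main_weight_def power_divide)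
  then have "0.02 * (0.33 * 1.3245) / 1.646 ^ Suc n \<le> main_weight / 1.646 ^ Suc n"
    by (rule divide_right_mono) simp
  then show ?thesis by (simp add: detour_bound_def)
qed

lemma right_line_subset_punctured_strip:
  assumes "0 \<le> p" "p \<le> q" "q \<le> box_bottom \<or> box_top \<le> p"
    and "t \<in> closed_segment (Complex pi p) (Complex pi q)"
  shows "t \<in> punctured_strip \<and> pi/2 < Re t"
  using assms by (auto simp: closed_segment_same_Re closed_segment_eq_real_ivl punctured_strip_def)

lemma right_line_integral_nonneg:
  assumes "0 \<le> p" "p < q" "q \<le> box_bottom \<or> box_top \<le> p"
  shows "0 \<le> Im (segment_integral (Complex pi p) (Complex pi q) (g0_kernel n))"
proof (rule Im_contour_integral_vertical_ge[OF assms(2)])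
  show "continuous_on (closed_segment (Complex pi p) (Complex pi q)) (g0_kernel n)"
    using right_line_subset_punctured_strip[OF assms(1) _ assms(3)] assms(2)
    by (intro holomorphic_on_imp_continuous_on g0_kernel_holomorphic) auto
  show "((\<lambda>_. 0) has_integral 0) {p..q}" by simp
  show "0 \<le> Re (g0_kernel n (Complex pi s))" if "s \<in> {p..q}" for s
    unfolding Re_g0_kernel_right_line using assms that
    by (intro divide_nonneg_nonneg g0_density_nonneg) auto
qed

lemma right_line_integral_ge_main_weight:
  "main_weight / 1.646 ^ Suc n \<le>
    Im (segment_integral (Complex pi 0) (Complex pi box_bottom) (g0_kernel n))"
proof (rule Im_contour_integral_vertical_ge)
  let ?w = "\<lambda>s::real. 0.02706 * (s ^ 4 + 2/3 * s ^ 6) / 1.646 ^ Suc n"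
  show "continuous_on (closed_segment (Complex pi 0) (Complex pi box_bottom)) (g0_kernel n)"
    using right_line_subset_punctured_strip[of 0 box_bottom]
    by (intro holomorphic_on_imp_continuous_on g0_kernel_holomorphic) auto
  show "((\<lambda>s. if s \<in> {0.7..1.05} then ?w s else 0) has_integral
      main_weight / 1.646 ^ Suc n) {0..box_bottom}"
    by (intro has_integral_restrict[THEN iffD2] has_integral_divide density_minorant_has_integral) auto
  fix s :: real assume s: "s \<in> {0..box_bottom}"
  then have nonneg: "0 \<le> g0_density s" by (intro g0_density_nonneg) auto
  show "(if s \<in> {0.7..1.05} then ?w s else 0) \<le> Re (g0_kernel n (Complex pi s))"
  proof (cases "s \<in> {0.7..1.05}")
    case True
    then have "cosh s ^ Suc n \<le> 1.646 ^ Suc n"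
      using cosh_sinh_middle(4)[of s] by (intro power_mono) auto
    then have "?w s \<le> g0_density s / cosh s ^ Suc n"
      using nonneg True by (intro frac_le g0_density_ge) auto
    then show ?thesis using True by (simp add: Re_g0_kernel_right_line)
  next
    case False
    have "0 \<le> g0_density s / cosh s ^ Suc n" using nonneg by (intro divide_nonneg_nonneg) auto
    then show ?thesis unfolding if_not_P[OF False] Re_g0_kernel_right_line .
  qed
qed simp

lemma contour_integral_around_zero_box:
  fixes n :: nat and R :: real
  assumes R: "box_top \<le> R"
  defines "I \<equiv> \<lambda>z w. segment_integral z w (g0_kernel n)"
    and "a \<equiv> box_left"
  shows "I (Complex a 0) (Complex a R) =
    I (Complex a 0) (Complex pi 0) + I (Complex pi 0) (Complex pi box_bottom)
    - I (Complex a box_bottom) (Complex pi box_bottom)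
    + I (Complex a box_bottom) (Complex a box_top)
    + I (Complex a box_top) (Complex pi box_top) + I (Complex pi box_top) (Complex pi R)
    - I (Complex a R) (Complex pi R)"
proof -
  have cont: "continuous_on (closed_segment (Complex a p) (Complex a q)) (g0_kernel n)" for p q
    using half_pi_less_box_left
    by (intro holomorphic_on_imp_continuous_on g0_kernel_holomorphic)
       (auto simp: closed_segment_same_Re a_def intro: strip_subset_punctured_strip)
  have split: "I (Complex a p) (Complex a r) =
      I (Complex a p) (Complex a q) + I (Complex a q) (Complex a r)"
    if "p \<le> q" "q \<le> r" for p q r
    unfolding I_def
    by (rule contour_integral_split_linepath[OF cont])
       (use that in \<open>simp add: closed_segment_same_Re closed_segment_eq_real_ivl\<close>)
  have shift: "I (Complex a p) (Complex a q) =
      I (Complex a p) (Complex pi p) + I (Complex pi p) (Complex pi q) - I (Complex a q) (Complex pi q)"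
    if "0 \<le> p" "p \<le> q" "q \<le> box_bottom \<or> box_top \<le> p" for p q
    unfolding I_def
  proof (rule contour_integral_vertical_shift)
    show "g0_kernel n holomorphic_on cbox (Complex a p) (Complex pi q)"
      using that half_pi_less_box_left
      by (intro g0_kernel_holomorphic) (auto simp: in_cbox_complex_iff punctured_strip_def a_def)
  qed (use that in \<open>auto simp: a_def\<close>)
  have "I (Complex a 0) (Complex a R) =
      I (Complex a 0) (Complex a box_bottom) +
      (I (Complex a box_bottom) (Complex a box_top) + I (Complex a box_top) (Complex a R))"
    using split[of 0 box_bottom R] split[of box_bottom box_top R] R by simp
  then show ?thesis
    using shift[of 0 box_bottom] shift[of box_top R] R by simp
qed

lemma detour_sides_integral_bounds:
  fixes n :: nat
  defines "I \<equiv> \<lambda>z w. segment_integral z w (g0_kernel n)"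
    and "a \<equiv> box_left"
  shows "\<bar>Im (I (Complex a box_bottom) (Complex pi box_bottom))\<bar> \<le> detour_bound n * 0.005"
    and "\<bar>Im (I (Complex a box_top) (Complex pi box_top))\<bar> \<le> detour_bound n * 0.005"
    and "\<bar>Im (I (Complex a box_bottom) (Complex a box_top))\<bar> \<le> detour_bound n * 0.01"
proof -
  have "cmod (I (Complex a box_bottom) (Complex pi box_bottom)) \<le> detour_bound n * 0.005"
    "cmod (I (Complex a box_top) (Complex pi box_top)) \<le> detour_bound n * 0.005"
    "cmod (I (Complex a box_bottom) (Complex a box_top)) \<le> detour_bound n * 0.01"
    unfolding I_def
    by (rule order_trans[OF detour_integral_bound];
        force simp: closed_segment_same_Im closed_segment_same_Re closed_segment_eq_real_ivl a_def
          detour_def zero_box_def in_cbox_complex_iff complex_diff cmod_def)+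
  then show "\<bar>Im (I (Complex a box_bottom) (Complex pi box_bottom))\<bar> \<le> detour_bound n * 0.005"
    "\<bar>Im (I (Complex a box_top) (Complex pi box_top))\<bar> \<le> detour_bound n * 0.005"
    "\<bar>Im (I (Complex a box_bottom) (Complex a box_top))\<bar> \<le> detour_bound n * 0.01"
    using abs_Im_le_cmod order_trans by blast+
qed

lemma top_segment_integral_bound:
  assumes R: "box_top \<le> R"
    and M: "\<And>t. \<lbrakk>0 \<le> Re t; Re t \<le> pi; Im t = R\<rbrakk> \<Longrightarrow> cmod (g0_kernel n t) \<le> M"
  shows "\<bar>Im (segment_integral (Complex box_left R) (Complex pi R) (g0_kernel n))\<bar> \<le> M * 0.005"
proof -
  let ?z = "Complex box_left R" and ?w = "Complex pi R"
  have segment: "0 \<le> Re t \<and> pi/2 < Re t \<and> Re t \<le> pi \<and> Im t = R" if "t \<in> closed_segment ?z ?w" for t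
    using that half_pi_less_box_left pi_gt_zero
    by (auto simp: closed_segment_same_Im closed_segment_eq_real_ivl)
  have "cmod (segment_integral ?z ?w (g0_kernel n)) \<le> M * cmod (?w - ?z)"
  proof (rule contour_integral_bound_linepath)
    show "g0_kernel n contour_integrable_on linepath ?z ?w"
      using R segment
      by (intro contour_integrable_continuous_linepath holomorphic_on_imp_continuous_on
          g0_kernel_holomorphic) (auto simp: punctured_strip_def)
    show "cmod (g0_kernel n t) \<le> M" if "t \<in> closed_segment ?z ?w" for t
      using segment[OF that] by (intro M) auto
    show "0 \<le> M" using order_trans[OF norm_ge_zero M[of "Complex 0 R"]] by simp
  qed
  also have "cmod (?w - ?z) = 0.005" by (simp add: complex_diff cmod_def)
  finally show ?thesis using abs_Im_le_cmod order_trans by blast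
qed

lemma left_line_integral_ge:
  assumes R: "box_top < R"
    and M: "\<And>t. \<lbrakk>0 \<le> Re t; Re t \<le> pi; Im t = R\<rbrakk> \<Longrightarrow> cmod (g0_kernel n t) \<le> M"
  shows "- (0.005 * M) \<le>
    Im (segment_integral (Complex box_left 0) (Complex box_left R) (g0_kernel n))"
proof -
  define a where "a = box_left"
  define I where "I z w = segment_integral z w (g0_kernel n)" for z w
  have "0 < a" using half_pi_less_box_left pi_gt_zero by (simp_all only: a_def)
  have bottom: "Im (I (Complex a 0) (Complex pi 0)) = 0"
    unfolding I_def
  proof (rule Im_contour_integral_real_segment)
    fix t assume "t \<in> closed_segment (Complex a 0) (Complex pi 0)"
    then have "t \<noteq> 0"
      using \<open>0 < a\<close> by (auto simp: closed_segment_same_Im closed_segment_eq_real_ivl a_def)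
    then show "g0_kernel n (cnj t) = cnj (g0_kernel n t)"
      by (rule g0_shifted.cos_kernel_cnj)
  qed
  have "0.02 * detour_bound n \<le> Im (I (Complex pi 0) (Complex pi box_bottom))"
    unfolding I_def using detour_contribution_le_main_weight right_line_integral_ge_main_weight
    by (rule order_trans)
  moreover have "0 \<le> Im (I (Complex pi box_top) (Complex pi R))"
    unfolding I_def by (rule right_line_integral_nonneg) (use R in simp_all)
  moreover have "\<bar>Im (I (Complex a R) (Complex pi R))\<bar> \<le> M * 0.005"
    unfolding I_def a_def by (rule top_segment_integral_bound[OF less_imp_le[OF R] M])
  moreover note bottom detour_sides_integral_bounds[of n, folded I_def a_def]
    contour_integral_around_zero_box[OF less_imp_le[OF R], of n, folded I_def a_def]
  ultimately show ?thesis
    unfolding I_def[symmetric] a_def[symmetric] by (simp add: abs_le_iff)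
qed

lemma cmod_denom_ge:
  assumes "R \<le> cmod t" "cmod t \<le> r" "0 \<le> s" "s \<le> cmod (sin t)" "s \<le> cmod (cos t)" "cmod (cos t) \<le> c"
  shows "R * s\<^sup>2 - (r\<^sup>2 + pi/2 * (1 + c)\<^sup>2) \<le> cmod (denom t)"
proof -
  have "R * s\<^sup>2 \<le> cmod t * (cmod (sin t) * cmod (cos t))"
    unfolding power2_eq_square using assms by (intro mult_mono) auto
  also have "\<dots> = cmod (t\<^sup>2 - of_real (pi/2) * (1 - cos t)\<^sup>2 - denom t)"
    by (simp add: denom_def norm_mult mult.assoc)
  also have "\<dots> \<le> r\<^sup>2 + pi/2 * (1 + c)\<^sup>2 + cmod (denom t)"
    by (intro norm_triangle_mono_diff norm_mult_mono norm_power_mono assms) simp_all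
  finally show ?thesis by simp
qed

lemma g0_shifted_lift_horizontal_bound:
  obtains G where "horizontal_bound g0_shifted_lift pi G"
    and "((\<lambda>R. G R * cosh R / sinh R ^ 2) \<longlongrightarrow> 0) at_top"
proof -
  define A B :: "real \<Rightarrow> real"
    where "A R = (R + pi)\<^sup>2 * cosh R + (R + pi) * cosh R + pi/2 * (1 + cosh R)\<^sup>2"
      and "B R = R * (sinh R)\<^sup>2 - ((R + pi)\<^sup>2 + pi/2 * (1 + cosh R)\<^sup>2)" for R
  define G where "G R = (crossover + cosh R) * (A R / B R) + box_value" for R
  have "\<forall>\<^sub>F R in at_top. 0 < B R"
    unfolding B_def cosh_field_def sinh_field_def by real_asymp
  then have "horizontal_bound g0_shifted_lift pi G"
    unfolding horizontal_bound_def using eventually_ge_at_top[of 1]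
  proof (eventually_elim, intro allI impI)
    fix R t assume R: "0 < B R" "1 \<le> R" and t: "0 \<le> Re t" "Re t \<le> pi" "Im t = R"
    have norm_t: "R \<le> cmod t" "cmod t \<le> R + pi" "t \<noteq> 0"
      using abs_Im_le_cmod[of t] cmod_le[of t] t R(2) by auto
    have trig: "cmod (cos t) \<le> cosh R" "cmod (sin t) \<le> cosh R"
      "sinh R \<le> cmod (cos t)" "sinh R \<le> cmod (sin t)"
      using cmod_cos_le[of t] cmod_sin_le[of t] cmod_cos_ge[of t] cmod_sin_ge[of t] t(3) by auto
    have "cmod (numer t) \<le> A R" unfolding A_def using norm_t trig by (intro cmod_numer_le)
    moreover have "B R \<le> cmod (denom t)"
      unfolding B_def using norm_t trig R(2) by (intro cmod_denom_ge) auto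
    ultimately have "cmod (g0_lift t) \<le> A R / B R"
      unfolding g0_lift_eq[OF norm_t(3)] norm_divide using R(1) order_trans[OF norm_ge_zero]
      by (intro frac_le) auto
    then show "cmod (g0_shifted_lift t) \<le> G R"
      unfolding g0_shifted_lift_def G_def
      by (intro norm_triangle_mono_diff norm_triangle_mono norm_mult_mono trig)
         (simp_all only: norm_of_real, simp_all)
  qed
  moreover have "((\<lambda>R. G R * cosh R / sinh R ^ 2) \<longlongrightarrow> 0) at_top"
    unfolding G_def A_def B_def cosh_field_def sinh_field_def by real_asymp
  ultimately show ?thesis by (rule that)
qed

lemma g0_shifted_Taylor_coeff_nonneg:
  assumes "1 \<le> n"
  shows "0 \<le> Re ((deriv ^^ n) (cos_descent g0_shifted_lift) 0)"
proof -
  obtain G where G: "horizontal_bound g0_shifted_lift pi G"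
    "((\<lambda>R. G R * cosh R / sinh R ^ 2) \<longlongrightarrow> 0) at_top"
    by (rule g0_shifted_lift_horizontal_bound)
  define M where "M R = G R * cosh R / sinh R ^ 2" for R
  have M: "horizontal_bound (g0_kernel n) pi M" "(M \<longlongrightarrow> 0) at_top"
    using horizontal_bound_cos_kernel[OF G(1), of 2 n] G(2) assms by (simp_all add: M_def[abs_def])
  show ?thesis
  proof (rule g0_shifted.Taylor_coeff_nonneg[OF horizontal_bound_antimono[OF M(1)] M(2)])
    show "box_left \<le> pi" by simp
    show "\<forall>\<^sub>F R in at_top. - (0.005 * M R) \<le>
        Im (segment_integral (Complex box_left 0) (Complex box_left R) (g0_kernel n))"
      using M(1)[unfolded horizontal_bound_def] eventually_gt_at_top[of box_top]
    proof eventually_elim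
      case (elim R)
      show ?case by (rule left_line_integral_ge[OF elim(2)]) (use elim(1) in blast)
    qed
    show "((\<lambda>R. 0.005 * M R) \<longlongrightarrow> 0) at_top" using M(2) by (rule tendsto_mult_right_zero)
  qed
qed

lemma g0_lift_of_real:
  assumes "0 \<le> x" "x \<le> 1"
  shows "g0_lift (of_real (arccos (- x))) = of_real (g0 x)"
proof -
  define s where "s = arccos (- x)"
  have s: "0 < s" "cos s = - x" "sin s = sqrt (1 - x\<^sup>2)" "arcsin x + pi/2 = s"
    using assms arccos_minus_pos by (simp_all add: s_def sin_arccos arcsin_plus_half_pi)
  have "g0_lift (of_real s) = of_real ((s\<^sup>2 * x + s * sqrt (1 - x\<^sup>2) - pi/2 * (1 + x)\<^sup>2) /
      (s\<^sup>2 + s * sqrt (1 - x\<^sup>2) * x - pi/2 * (1 + x)\<^sup>2))"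
    using s(1) by (simp add: g0_lift_eq numer_of_real denom_of_real s(2,3))
  also have "(s\<^sup>2 * x + s * sqrt (1 - x\<^sup>2) - pi/2 * (1 + x)\<^sup>2) /
      (s\<^sup>2 + s * sqrt (1 - x\<^sup>2) * x - pi/2 * (1 + x)\<^sup>2) = g0 x"
    unfolding g0_def s(4) by (simp add: mult_ac)
  finally show ?thesis unfolding s_def .
qed

lemma g0_continuous: "continuous_on {0..1} g0"
proof -
  have "of_real (arccos (- x)) \<in> punctured_strip" if "x \<in> {0..1}" for x
    using that arccos_lbound[of "- x"] arccos_ubound[of "- x"] by (simp add: punctured_strip_def)
  then have "continuous_on ((\<lambda>x. of_real (arccos (- x))) ` {0..1}) g0_lift"
    using denom_red_nonzero
    by (intro continuous_on_subset[OF holomorphic_on_imp_continuous_on[OF g0.holomorphic]]) auto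
  moreover have "continuous_on {0..1} (\<lambda>x. complex_of_real (arccos (- x)))"
    by (intro continuous_intros) auto
  ultimately have "continuous_on {0..1} (\<lambda>x. g0_lift (of_real (arccos (- x))))"
    by (rule continuous_on_compose2) simp
  then have "continuous_on {0..1} (\<lambda>x. Re (g0_lift (of_real (arccos (- x)))))"
    by (rule continuous_on_Re)
  then show ?thesis
    by (rule continuous_on_eq) (simp add: g0_lift_of_real)
qed

lemma g0_Taylor_coeff_nonneg: "0 \<le> Re ((deriv ^^ n) (cos_descent g0_lift) 0)"
proof (induction n)
  case 0
  have "g0 0 = 0" by (simp add: g0_def power2_eq_square)
  then show ?case using cos_descent_of_real[of 0 g0_lift] g0_lift_of_real[of 0] by simp
next
  case (Suc n)
  let ?c = "\<lambda>n. Re ((deriv ^^ n) (cos_descent g0_lift) 0)"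
  have "(deriv ^^ Suc n) (cos_descent g0_shifted_lift) 0 =
      (of_real crossover - 0) * (deriv ^^ Suc n) (cos_descent g0_lift) 0 -
      of_nat (Suc n) * (deriv ^^ n) (cos_descent g0_lift) 0"
    unfolding cos_descent_g0_shifted_lift
    by (rule higher_deriv_linear_times[OF g0.cos_descent_holomorphic]) auto
  then have "Re ((deriv ^^ Suc n) (cos_descent g0_shifted_lift) 0) =
      crossover * ?c (Suc n) - real (Suc n) * ?c n"
    by (simp del: funpow.simps of_nat_Suc)
  then have "real (Suc n) * ?c n \<le> crossover * ?c (Suc n)"
    using g0_shifted_Taylor_coeff_nonneg[of "Suc n"] by linarith
  moreover have "0 \<le> real (Suc n) * ?c n" using Suc.IH by (intro mult_nonneg_nonneg) auto
  ultimately have "0 \<le> crossover * ?c (Suc n)" by (rule order_trans[rotated])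
  then show ?case by (simp add: zero_le_mult_iff del: funpow.simps)
qed

theorem absolutely_monotone_g0: "absolutely_monotone_01 g0"
  by (rule g0.absolutely_monotone_01[OF g0_Taylor_coeff_nonneg _ g0_continuous])
     (simp add: g0_lift_of_real)

theorem theorem4p2:
  shows "absolutely_monotone_01 f0 \<and> absolutely_monotone_01 g0"
  using absolutely_monotone_f0 absolutely_monotone_g0 by (rule conjI)

end
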